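(* There is no non-computable subsequence set for $1$-genericity. That is, for every non-computable $I \subseteq \omega$ there is a $1$-generic set $G \subseteq \omega$ such that $G_I$ is not $1$-generic.
   Context: Subsets of $\omega$ are identified with their characteristic functions, i.e. with elements of $2^{\omega}$. For $\sigma \in 2^{<\omega}$ and $G \in 2^{\omega}$, $\sigma \prec G$ means that $\sigma$ is an initial segment of $G$. A set $G \subseteq \omega$ is $1$-generic if for every c.e. set $W \subseteq 2^{<\omega}$ there is $\sigma \prec G$ such that either $\sigma \in W$ or no $\tau \in 2^{<\omega}$ extending $\sigma$ belongs to $W$. For an infinite set $I = \{i_0 < i_1 < i_2 < \cdots\} \subseteq \omega$, its principal function $P_I$ is defined by $P_I(n) = i_n$ for all $n \in \omega$. For $A \subseteq \omega$, the $I$-subsequence of $A$ is the set $A_I$ defined by $A_I(n) = A(P_I(n))$ for all $n \in \omega$. A set $I$ is a subsequence set for $1$-genericity if for all $G \subseteq \omega$, if $G$ is $1$-generic then $G_I$ is also $1$-generic. *)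

theory Defs
  imports Main "HOL-Library.Infinite_Set" "HOL-Library.Sublist"
begin

text \<open>
  \<open>recursive_fn n f\<close>: \<open>f\<close>, restricted to argument lists of length \<open>n\<close>, is a total recursive
  function of \<open>n\<close> variables.  The values of \<open>f\<close> on lists of any other length are irrelevant.
  This is Kleene's class of general recursive functions, in which minimisation is applied only
  where it yields a total function, so that no partial functions are needed.
\<close>

inductive recursive_fn :: "nat \<Rightarrow> (nat list \<Rightarrow> nat) \<Rightarrow> bool" where
  zero: "recursive_fn n (\<lambda>_. 0)"
| succ: "recursive_fn 1 (\<lambda>xs. Suc (hd xs))"
| proj: "i < n \<Longrightarrow> recursive_fn n (\<lambda>xs. xs ! i)"
| comp: "recursive_fn (length gs) f \<Longrightarrow> (\<forall>g\<in>set gs. recursive_fn n g) \<Longrightarrow>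
    recursive_fn n (\<lambda>xs. f (map (\<lambda>g. g xs) gs))"
| prim_rec: "recursive_fn n f \<Longrightarrow> recursive_fn (Suc (Suc n)) g \<Longrightarrow>
    recursive_fn (Suc n)
      (\<lambda>xs. rec_nat (f (tl xs)) (\<lambda>k r. g (k # r # tl xs)) (hd xs))"
| mu: "recursive_fn (Suc n) f \<Longrightarrow> (\<forall>xs. length xs = n \<longrightarrow> (\<exists>k. f (k # xs) = 0)) \<Longrightarrow>
    recursive_fn n (\<lambda>xs. LEAST k. f (k # xs) = 0)"

definition computable :: "(nat \<Rightarrow> nat) \<Rightarrow> bool" where
  "computable f \<longleftrightarrow> (\<exists>g. recursive_fn 1 g \<and> (\<forall>x. f x = g [x]))"

definition computable_set :: "nat set \<Rightarrow> bool" where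
  "computable_set A \<longleftrightarrow> computable (\<lambda>n. of_bool (n \<in> A))"

definition ce_set :: "nat set \<Rightarrow> bool" where
  "ce_set A \<longleftrightarrow> A = {} \<or> (\<exists>f. computable f \<and> A = range f)"

text \<open>The usual effective bijection between binary strings and natural numbers
  (bijective base 2, least significant digit first).\<close>

primrec string_code :: "bool list \<Rightarrow> nat" where
  "string_code [] = 0"
| "string_code (b # \<sigma>) = 2 * string_code \<sigma> + (if b then 2 else 1)"

lemma bij_string_code: "bij string_code"
proof (rule bijI)
  show "inj string_code"
  proof (rule injI)
    fix \<sigma> \<tau> assume "string_code \<sigma> = string_code \<tau>"
    then show "\<sigma> = \<tau>"
    proof (induction \<sigma> arbitrary: \<tau>)
      case Nil
      then show ?case by (cases \<tau>) (auto split: if_splits)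
    next
      case (Cons b \<sigma>)
      then obtain c \<tau>' where \<tau>: "\<tau> = c # \<tau>'" by (cases \<tau>) (auto split: if_splits)
      from Cons.prems have "b = c \<and> string_code \<sigma> = string_code \<tau>'"
        unfolding \<tau> by (cases b; cases c; simp; presburger)
      with Cons.IH \<tau> show ?case by simp
    qed
  qed
  have "\<exists>\<sigma>. string_code \<sigma> = n" for n
  proof (induction n rule: less_induct)
    case (less n)
    show ?case
    proof (cases "n = 0")
      case True
      then have "string_code [] = n" by simp
      then show ?thesis ..
    next
      case False
      then have "(n - 1) div 2 < n" by presburger
      then obtain \<sigma> where "string_code \<sigma> = (n - 1) div 2"
        using less.IH by blast
      then have "string_code (even n # \<sigma>) = n"
        using False by simp presburger
      then show ?thesis ..
    qed
  qed
  then show "surj string_code" unfolding surj_def by metis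
qed

definition ce_strings :: "bool list set \<Rightarrow> bool" where
  "ce_strings W \<longleftrightarrow> ce_set (string_code ` W)"

definition initial_segment :: "bool list \<Rightarrow> nat set \<Rightarrow> bool" where
  "initial_segment \<sigma> G \<longleftrightarrow> (\<forall>i < length \<sigma>. \<sigma> ! i \<longleftrightarrow> i \<in> G)"

definition one_generic :: "nat set \<Rightarrow> bool" where
  "one_generic G \<longleftrightarrow>
    (\<forall>W. ce_strings W \<longrightarrow>
      (\<exists>\<sigma>. initial_segment \<sigma> G \<and> (\<sigma> \<in> W \<or> \<not> (\<exists>\<tau>. prefix \<sigma> \<tau> \<and> \<tau> \<in> W))))"

text \<open>For infinite \<open>I\<close>, \<open>enumerate I\<close> is the principal function of \<open>I\<close>; for finite \<open>I\<close> the
  \<open>I\<close>-subsequence is not meaningful.\<close>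

definition subsequence :: "nat set \<Rightarrow> nat set \<Rightarrow> nat set" where
  "subsequence I A = {n. enumerate I n \<in> A}"

definition subsequence_set_1_generic :: "nat set \<Rightarrow> bool" where
  "subsequence_set_1_generic I \<longleftrightarrow>
    infinite I \<and> (\<forall>G. one_generic G \<longrightarrow> one_generic (subsequence I G))"

end

theory Submission
  imports Defs "HOL-Library.Nat_Bijection"
begin

text \<open>
  Let \<open>I\<close> be non-computable, hence infinite.  A \<open>1\<close>-generic \<open>G\<close> is built by finite extensions
  \<open>\<sigma>\<^sub>0 \<prec> \<sigma>\<^sub>1 \<prec> \<dots>\<close>, where each step decides one c.e. set of strings
  (\<open>generic_from_extensions\<close>).  The work lies in keeping \<open>G\<^sub>I\<close> away from \<open>1\<close>-genericity while the
  extension that meets a c.e. set is dictated by that set.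

  Suppose first that no computable \<open>f\<close> bounds the gaps of \<open>I\<close>, in the sense that every interval
  \<open>[n, f n)\<close> meets \<open>I\<close>.  Then \<open>G\<close> can be chosen above \<open>I\<close>, so that \<open>G\<^sub>I\<close> is all of \<open>\<omega>\<close>: if every
  \<open>\<sigma>1\<^sup>n\<close> has an extension in the c.e. set \<open>V\<close>, then the length of such an extension is a computable
  function of \<open>n\<close>, and for some \<open>n\<close> the part added beyond \<open>\<sigma>1\<^sup>n\<close> falls into a gap of \<open>I\<close>, where it
  does no harm (\<open>generic_superset\<close>).

  Now let the computable \<open>f\<close> bound the gaps of \<open>I\<close>.  The aim is that \<open>G\<^sub>I\<close> be a sequence of messages,
  separated by stretches of arbitrary bits, from which a computable reader learns where the next
  message begins.  Every message starts with a \<open>1\<close>, so \<open>G\<^sub>I\<close> avoids the c.e. set of all strings that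
  consist of complete messages followed by a \<open>0\<close>, although it has arbitrarily long initial segments
  with an extension in that set; hence \<open>G\<^sub>I\<close> is not \<open>1\<close>-generic (\<open>not_one_generic_if_parsed\<close>).

  A message serves to extend \<open>\<sigma>\<close> to a string that decides the \<open>e\<close>-th c.e. set \<open>V\<close>.  In \<open>G\<close> it is a
  block of ones, then a block of zeros up to some position \<open>n\<close>, then a block of ones up to \<open>f n\<close>.  The
  first block ends at a point that depends only on an index \<open>k\<close> coding \<open>\<sigma>\<close>, \<open>e\<close> and a bit \<open>i\<close>.  The
  reader sees \<open>1\<^sup>c 0\<^sup>r 1\<dots>\<close>, where \<open>c\<close> and \<open>r\<close> count elements of \<open>I\<close>.  It does not know \<open>I\<close>, but
  the blocks grow so fast that \<open>c\<close> determines \<open>k\<close> whatever \<open>I\<close> is; so it knows \<open>\<sigma>\<close>, \<open>e\<close> and \<open>i\<close>, though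
  not \<open>n\<close>.  What it sees of \<open>n\<close> is the parity of \<open>c + r\<close>, the number \<open>R n\<close> of elements of \<open>I\<close>
  between \<open>\<bar>\<sigma>\<bar>\<close> and \<open>n\<close>.  If this parity differs from \<open>i\<close>, the message is over at the next \<open>0\<close>.  If it
  equals \<open>i\<close>, the reader searches for some \<open>n\<close> such that the message for \<open>n\<close> has an extension in \<open>V\<close>
  both when the bit is \<open>0\<close> and when it is \<open>1\<close>, and it ignores as many of the following bits as such an
  extension may occupy.

  Non-computability of \<open>I\<close> ensures that one of the two ways of deciding \<open>V\<close> is open
  (\<open>extend_parsed\<close>).  If some \<open>n\<close> is as in the search, take the first one found and the bit
  \<open>i = R n mod 2\<close>: the extension into \<open>V\<close> lies in the stretch that the reader ignores.  If for some
  \<open>n\<close> and \<open>i \<noteq> R n mod 2\<close> the message has no extension in \<open>V\<close>, use that message, which the reader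
  regards as finished.  If both fail, then among the bits \<open>0\<close> and \<open>1\<close> exactly \<open>i \<noteq> R n mod 2\<close> gives a
  message with an extension in \<open>V\<close>, for all large \<open>n\<close>.  So the parity of \<open>R\<close> is computable, and \<open>n \<in> I\<close>
  holds iff \<open>R n\<close> and \<open>R (n + 1)\<close> have different parities: \<open>I\<close> would be computable.

  That the set of strings avoided by \<open>G\<^sub>I\<close> is c.e. requires an enumeration theorem
  (\<open>universal_ce_set\<close>), since the reader handles all c.e. sets \<open>V\<close> uniformly.  It is proved by an
  evaluation relation for coded programs; both this relation and the set of parsed strings are
  instances of closure under a c.e. rule (\<open>ce_gen\<close>).
\<close>

section \<open>Basic computable functions\<close>

text \<open>
  Values on lists of the wrong length are left open, so that functions can be compared up to
  extensionality on lists of length \<open>n\<close>.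
\<close>

definition rf :: "nat \<Rightarrow> (nat list \<Rightarrow> nat) \<Rightarrow> bool" where
  "rf n h \<longleftrightarrow> (\<exists>g. recursive_fn n g \<and> (\<forall>xs. length xs = n \<longrightarrow> h xs = g xs))"

definition computable2 :: "(nat \<Rightarrow> nat \<Rightarrow> nat) \<Rightarrow> bool" where
  "computable2 h \<longleftrightarrow> rf 2 (\<lambda>xs. h (xs ! 0) (xs ! 1))"

lemma computable_iff_rf: "computable f \<longleftrightarrow> rf 1 (\<lambda>xs. f (xs ! 0))"
proof
  assume "computable f"
  then obtain g where g: "recursive_fn 1 g" "\<And>x. f x = g [x]"
    unfolding computable_def by blast
  have "f (xs ! 0) = g xs" if "length xs = 1" for xs
    using that g(2) by (cases xs) auto
  with g(1) show "rf 1 (\<lambda>xs. f (xs ! 0))" unfolding rf_def by blast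
next
  assume "rf 1 (\<lambda>xs. f (xs ! 0))"
  then obtain g where g: "recursive_fn 1 g" "\<And>xs. length xs = 1 \<Longrightarrow> f (xs ! 0) = g xs"
    unfolding rf_def by blast
  then have "f x = g [x]" for x using g(2)[of "[x]"] by simp
  with g(1) show "computable f" unfolding computable_def by blast
qed

lemma rf_zero: "rf n (\<lambda>_. 0)"
  unfolding rf_def using recursive_fn.zero by blast

lemma rf_nth: "i < n \<Longrightarrow> rf n (\<lambda>xs. xs ! i)"
  unfolding rf_def using recursive_fn.proj by blast

lemma rf_comp1:
  assumes "computable f" "rf n a"
  shows "rf n (\<lambda>xs. f (a xs))"
proof -
  obtain g where g: "recursive_fn 1 g" "\<And>x. f x = g [x]"
    using assms(1) unfolding computable_def by blast
  obtain a' where a': "recursive_fn n a'" "\<And>xs. length xs = n \<Longrightarrow> a xs = a' xs"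
    using assms(2) unfolding rf_def by blast
  have "recursive_fn n (\<lambda>xs. g (map (\<lambda>h. h xs) [a']))"
    using g(1) a'(1) by (intro recursive_fn.comp) auto
  then show ?thesis unfolding rf_def using g(2) a'(2) by auto
qed

lemma rf_comp2:
  assumes "computable2 h" "rf n a" "rf n b"
  shows "rf n (\<lambda>xs. h (a xs) (b xs))"
proof -
  obtain g where g: "recursive_fn 2 g" "\<And>xs. length xs = 2 \<Longrightarrow> h (xs ! 0) (xs ! 1) = g xs"
    using assms(1) unfolding computable2_def rf_def by blast
  have g': "h x y = g [x, y]" for x y using g(2)[of "[x, y]"] by simp
  obtain a' where a': "recursive_fn n a'" "\<And>xs. length xs = n \<Longrightarrow> a xs = a' xs"
    using assms(2) unfolding rf_def by blast
  obtain b' where b': "recursive_fn n b'" "\<And>xs. length xs = n \<Longrightarrow> b xs = b' xs"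
    using assms(3) unfolding rf_def by blast
  have "recursive_fn n (\<lambda>xs. g (map (\<lambda>h. h xs) [a', b']))"
    using g(1) a'(1) b'(1) by (intro recursive_fn.comp) (auto simp: numeral_2_eq_2)
  then show ?thesis unfolding rf_def using g' a'(2) b'(2) by auto
qed

text \<open>
  The recursion variable is the head of the argument list and the parameters form its tail, as in
  the rule for primitive recursion.
\<close>

lemma rf_rec:
  assumes "rf n a" "rf (Suc (Suc n)) g"
  shows "rf (Suc n) (\<lambda>xs. rec_nat (a (tl xs)) (\<lambda>k r. g (k # r # tl xs)) (hd xs))"
proof -
  obtain a' where a': "recursive_fn n a'" "\<And>xs. length xs = n \<Longrightarrow> a xs = a' xs"
    using assms(1) unfolding rf_def by blast
  obtain g' where g': "recursive_fn (Suc (Suc n)) g'"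
      "\<And>xs. length xs = Suc (Suc n) \<Longrightarrow> g xs = g' xs"
    using assms(2) unfolding rf_def by blast
  have "rec_nat (a (tl xs)) (\<lambda>k r. g (k # r # tl xs)) (hd xs)
      = rec_nat (a' (tl xs)) (\<lambda>k r. g' (k # r # tl xs)) (hd xs)" if "length xs = Suc n" for xs
    using that a'(2) g'(2) by (intro arg_cong3[of _ _ _ _ _ _ rec_nat] ext) auto
  then show ?thesis unfolding rf_def using recursive_fn.prim_rec[OF a'(1) g'(1)] by blast
qed

lemma length_2_D: "length xs = 2 \<Longrightarrow> xs = [xs ! 0, xs ! 1]"
  by (auto simp: numeral_2_eq_2 length_Suc_conv)

lemma computable2_rec:
  assumes "computable a" "rf 3 g"
  shows "computable2 (\<lambda>m x. rec_nat (a x) (\<lambda>k r. g [k, r, x]) m)"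
proof -
  have "rf (Suc 1) (\<lambda>xs. rec_nat (a (tl xs ! 0)) (\<lambda>k r. g (k # r # tl xs)) (hd xs))"
    using assms by (intro rf_rec) (auto simp: computable_iff_rf numeral_3_eq_3)
  then obtain h where h: "recursive_fn 2 h"
    "\<And>xs. length xs = 2 \<Longrightarrow> rec_nat (a (tl xs ! 0)) (\<lambda>k r. g (k # r # tl xs)) (hd xs) = h xs"
    unfolding rf_def by (auto simp: numeral_2_eq_2)
  have "rec_nat (a (xs ! 1)) (\<lambda>k r. g [k, r, xs ! 1]) (xs ! 0) = h xs" if "length xs = 2" for xs
    using h(2)[OF that] length_2_D[OF that] by (metis list.sel(1,3) nth_Cons_0)
  with h(1) show ?thesis unfolding computable2_def rf_def by blast
qed

lemma computable_Suc: "computable Suc"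
  unfolding computable_def using recursive_fn.succ by force

lemma computable_ident: "computable (\<lambda>x. x)"
  using rf_nth[of 0 1] by (simp add: computable_iff_rf)

lemma computable_compose: "computable f \<Longrightarrow> computable g \<Longrightarrow> computable (\<lambda>x. f (g x))"
  using rf_comp1[of f 1 "\<lambda>xs. g (xs ! 0)"] by (simp add: computable_iff_rf)

lemma computable2_compose:
  "computable2 h \<Longrightarrow> computable f \<Longrightarrow> computable g \<Longrightarrow> computable (\<lambda>x. h (f x) (g x))"
  using rf_comp2[of h 1 "\<lambda>xs. f (xs ! 0)" "\<lambda>xs. g (xs ! 0)"] by (simp add: computable_iff_rf)

lemma computable_const: "computable (\<lambda>_. c)"
proof (induction c)
  case 0
  then show ?case using rf_zero[of 1] by (simp add: computable_iff_rf)
next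
  case (Suc c)
  then show ?case using computable_compose[OF computable_Suc] by simp
qed

lemma computable2_add: "computable2 (+)"
proof -
  have "rf 3 (\<lambda>xs. Suc (xs ! 1))" by (intro rf_comp1[OF computable_Suc] rf_nth) auto
  from computable2_rec[OF computable_ident this]
  have "computable2 (\<lambda>m x. rec_nat x (\<lambda>k r. Suc r) m)" by simp
  moreover have "rec_nat x (\<lambda>k r. Suc r) m = m + x" for m x by (induction m) auto
  ultimately show ?thesis by simp
qed

lemma computable2_mult: "computable2 (*)"
proof -
  have "rf 3 (\<lambda>xs. xs ! 1 + xs ! 2)" by (intro rf_comp2[OF computable2_add] rf_nth) auto
  from computable2_rec[OF computable_const[of 0] this]
  have "computable2 (\<lambda>m x. rec_nat 0 (\<lambda>k r. r + x) m)" by (simp add: numeral_2_eq_2)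
  moreover have "rec_nat 0 (\<lambda>k r. r + x) m = m * x" for m x by (induction m) auto
  ultimately show ?thesis by simp
qed

lemma computable_pred: "computable (\<lambda>x. x - 1)"
proof -
  have "rf 3 (\<lambda>xs. xs ! 0)" by (intro rf_nth) auto
  from computable2_rec[OF computable_const[of 0] this]
  have "computable2 (\<lambda>m x. rec_nat 0 (\<lambda>k r. k) m)" by simp
  from computable2_compose[OF this computable_ident computable_ident]
  have "computable (\<lambda>m. rec_nat 0 (\<lambda>k r. k) m)" by simp
  moreover have "rec_nat 0 (\<lambda>k r. k) m = m - 1" for m :: nat by (cases m) auto
  ultimately show ?thesis by simp
qed

lemma computable_add: "computable f \<Longrightarrow> computable g \<Longrightarrow> computable (\<lambda>x. f x + g x)"
  by (rule computable2_compose[OF computable2_add])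

lemma computable_mult: "computable f \<Longrightarrow> computable g \<Longrightarrow> computable (\<lambda>x. f x * g x)"
  by (rule computable2_compose[OF computable2_mult])

lemma computable2_diff: "computable2 (\<lambda>m x. x - m)"
proof -
  have "rf 3 (\<lambda>xs. xs ! 1 - 1)" by (intro rf_comp1[OF computable_pred] rf_nth) auto
  from computable2_rec[OF computable_ident this]
  have "computable2 (\<lambda>m x. rec_nat x (\<lambda>k r. r - 1) m)" by simp
  moreover have "rec_nat x (\<lambda>k r. r - 1) m = x - m" for m x :: nat by (induction m) auto
  ultimately show ?thesis by simp
qed

lemma computable_diff: "computable f \<Longrightarrow> computable g \<Longrightarrow> computable (\<lambda>x. f x - g x)"
  by (rule computable2_compose[OF computable2_diff])

lemma computable_Suc_comp: "computable f \<Longrightarrow> computable (\<lambda>x. Suc (f x))"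
  by (rule computable_compose[OF computable_Suc])

lemma computable_triangle: "computable triangle"
proof -
  have "rf 3 (\<lambda>xs. xs ! 1 + Suc (xs ! 0))"
    by (intro rf_comp2[OF computable2_add] rf_comp1[OF computable_Suc] rf_nth) auto
  from computable2_rec[OF computable_const[of 0] this]
  have "computable2 (\<lambda>m x. rec_nat 0 (\<lambda>k r. r + Suc k) m)" by simp
  from computable2_compose[OF this computable_ident computable_ident]
  have "computable (\<lambda>m. rec_nat 0 (\<lambda>k r. r + Suc k) m)" by simp
  moreover have "rec_nat 0 (\<lambda>k r. r + Suc k) m = triangle m" for m by (induction m) auto
  ultimately show ?thesis by simp
qed

text \<open>
  With a computable pairing, unary functions suffice: a context of several variables is one
  number, and the rules below are closure properties of functions of that single variable.
\<close>

definition pair :: "nat \<Rightarrow> nat \<Rightarrow> nat" where "pair a b = prod_encode (a, b)"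
definition pfst :: "nat \<Rightarrow> nat" where "pfst z = fst (prod_decode z)"
definition psnd :: "nat \<Rightarrow> nat" where "psnd z = snd (prod_decode z)"

lemma pfst_pair [simp]: "pfst (pair a b) = a" by (simp add: pfst_def pair_def)
lemma psnd_pair [simp]: "psnd (pair a b) = b" by (simp add: psnd_def pair_def)
lemma pair_proj [simp]: "pair (pfst z) (psnd z) = z" by (simp add: pair_def pfst_def psnd_def)
lemma pair_eq_iff [simp]: "pair a b = pair c d \<longleftrightarrow> a = c \<and> b = d" by (simp add: pair_def)
lemma le_pair_1: "a \<le> pair a b" by (simp add: pair_def le_prod_encode_1)
lemma le_pair_2: "b \<le> pair a b" by (simp add: pair_def le_prod_encode_2)

lemma pfst_le: "pfst t \<le> t" and psnd_le: "psnd t \<le> t"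
  using le_pair_1[of "pfst t" "psnd t"] le_pair_2[of "psnd t" "pfst t"] by simp_all

lemma computable2_pair: "computable2 pair"
proof -
  have "rf 2 (\<lambda>xs. triangle (xs ! 0 + xs ! 1) + xs ! 0)"
    by (intro rf_comp2[OF computable2_add] rf_comp1[OF computable_triangle] rf_nth) auto
  then show ?thesis by (simp add: computable2_def pair_def prod_encode_def)
qed

lemma computable_pair: "computable f \<Longrightarrow> computable g \<Longrightarrow> computable (\<lambda>x. pair (f x) (g x))"
  by (rule computable2_compose[OF computable2_pair])

lemma computable_Least_zero:
  assumes "computable F" "\<And>x. \<exists>k. F (pair k x) = 0"
  shows "computable (\<lambda>x. LEAST k. F (pair k x) = 0)"
proof -
  have "rf (Suc 1) (\<lambda>xs. F (pair (xs ! 0) (xs ! 1)))"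
    by (intro rf_comp1[OF assms(1)] rf_comp2[OF computable2_pair] rf_nth) auto
  then obtain g where g: "recursive_fn (Suc 1) g"
    "\<And>xs. length xs = Suc 1 \<Longrightarrow> F (pair (xs ! 0) (xs ! 1)) = g xs"
    unfolding rf_def by blast
  have g': "F (pair k x) = g [k, x]" for k x using g(2)[of "[k, x]"] by simp
  have "recursive_fn 1 (\<lambda>xs. LEAST k. g (k # xs) = 0)"
    using g(1)
  proof (rule recursive_fn.mu, intro allI impI)
    fix xs :: "nat list" assume "length xs = 1"
    then obtain x where "xs = [x]" by (auto simp: length_Suc_conv)
    then show "\<exists>k. g (k # xs) = 0" using assms(2)[of x] g' by simp
  qed
  then show ?thesis unfolding computable_def using g' by auto
qed

text \<open>
  The code of \<open>(a, b)\<close> is \<open>triangle (a + b) + a\<close> with \<open>a \<le> a + b\<close>, so \<open>a + b\<close> is the largest \<open>s\<close>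
  with \<open>triangle s\<close> below the code.  The condition is written with truncated subtraction because
  minimisation looks for a zero.
\<close>

lemma prod_decode_root:
  defines "s \<equiv> \<lambda>z. LEAST s. Suc z - triangle (Suc s) = 0"
  shows "pfst z = z - triangle (s z)" "psnd z = s z - pfst z"
proof -
  obtain a b where ab: "z = pair a b" using pair_proj by metis
  have *: "triangle m \<le> triangle n" if "m \<le> n" for m n
    using that by (induction n rule: dec_induct) auto
  have "s z = a + b" unfolding s_def
  proof (rule Least_equality)
    show "Suc z - triangle (Suc (a + b)) = 0" by (simp add: ab pair_def prod_encode_def)
    fix y assume "Suc z - triangle (Suc y) = 0"
    then show "a + b \<le> y" using *[of "Suc y" "a + b"]
      by (force simp: ab pair_def prod_encode_def not_le[symmetric])
  qed
  then show "pfst z = z - triangle (s z)" "psnd z = s z - pfst z"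
    by (simp_all add: ab) (simp add: pair_def prod_encode_def)
qed

lemma computable_root: "computable (\<lambda>z. LEAST s. Suc z - triangle (Suc s) = 0)"
proof -
  \<comment> \<open>Before the projections are available, the pair of the search variable and of the argument
    cannot be taken apart, so the minimisation is done on argument lists.\<close>
  have "rf (Suc 1) (\<lambda>xs. Suc (xs ! 1) - triangle (Suc (xs ! 0)))"
    by (rule rf_comp2[OF computable2_diff])
      (intro rf_comp1[OF computable_Suc] rf_comp1[OF computable_triangle] rf_nth; simp)+
  then obtain g where g: "recursive_fn (Suc 1) g"
    "\<And>xs. length xs = Suc 1 \<Longrightarrow> Suc (xs ! 1) - triangle (Suc (xs ! 0)) = g xs"
    unfolding rf_def by blast
  have g': "Suc x - triangle (Suc k) = g [k, x]" for k x using g(2)[of "[k, x]"] by simp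
  have "recursive_fn 1 (\<lambda>xs. LEAST k. g (k # xs) = 0)"
    using g(1)
  proof (rule recursive_fn.mu, intro allI impI)
    fix xs :: "nat list" assume "length xs = 1"
    then obtain x where "xs = [x]" by (auto simp: length_Suc_conv)
    moreover have "x \<le> triangle x" by (induction x) auto
    ultimately show "\<exists>k. g (k # xs) = 0" using g'[of x x] by (auto intro!: exI[of _ x])
  qed
  then show ?thesis unfolding computable_def using g' by auto
qed

section \<open>Computable functions, decidable and c.e. predicates\<close>

lemma computable_pfst: "computable f \<Longrightarrow> computable (\<lambda>x. pfst (f x))"
  and computable_psnd: "computable f \<Longrightarrow> computable (\<lambda>x. psnd (f x))"
proof -
  have root: "computable (\<lambda>z. LEAST s. Suc z - triangle (Suc s) = 0)"
    by (rule computable_root)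
  have 1: "computable pfst"
    by (subst ext[OF prod_decode_root(1)])
      (intro computable_diff computable_ident computable_compose[OF computable_triangle] root)
  then have 2: "computable psnd"
    by (subst ext[OF prod_decode_root(2)]) (intro computable_diff root)
  show "computable f \<Longrightarrow> computable (\<lambda>x. pfst (f x))" by (rule computable_compose[OF 1])
  show "computable f \<Longrightarrow> computable (\<lambda>x. psnd (f x))" by (rule computable_compose[OF 2])
qed

text \<open>
  The premise on \<open>g\<close> speaks of a function of one variable \<open>z\<close>, which packs the recursion counter,
  the previous value and the parameter.  In this form recursion is an introduction rule.
\<close>

lemma computable_rec:
  assumes "computable a"
    and g: "computable (\<lambda>z. g (pfst z) (pfst (psnd z)) (psnd (psnd z)))"
    and "computable h"
  shows "computable (\<lambda>x. rec_nat (a x) (\<lambda>k r. g k r x) (h x))"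
proof -
  have "rf 3 (\<lambda>xs. (\<lambda>z. g (pfst z) (pfst (psnd z)) (psnd (psnd z)))
      (pair (xs ! 0) (pair (xs ! 1) (xs ! 2))))"
    by (rule rf_comp1[OF g]) (intro rf_comp2[OF computable2_pair] rf_nth; simp)
  then have "rf 3 (\<lambda>xs. g (xs ! 0) (xs ! 1) (xs ! 2))" by simp
  from computable2_rec[OF assms(1) this]
  have "computable2 (\<lambda>m x. rec_nat (a x) (\<lambda>k r. g k r x) m)" by (simp add: numeral_2_eq_2)
  from computable2_compose[OF this assms(3) computable_ident] show ?thesis by simp
qed

lemma computable_power2:
  assumes "computable f" shows "computable (\<lambda>x. 2 ^ f x)"
proof -
  have "computable (\<lambda>x. rec_nat 1 (\<lambda>_ r. 2 * r) (f x))"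
    by (intro computable_rec computable_mult computable_const computable_pfst computable_psnd
        computable_ident assms)
  moreover have "rec_nat 1 (\<lambda>_ r. 2 * r) m = (2::nat) ^ m" for m :: nat by (induction m) auto
  ultimately show ?thesis by simp
qed

lemma computable_mod2:
  assumes "computable f" shows "computable (\<lambda>x. f x mod 2)"
proof -
  have "computable (\<lambda>x. rec_nat 0 (\<lambda>_ r. 1 - r) (f x))"
    by (intro computable_rec computable_diff computable_const computable_pfst computable_psnd
        computable_ident assms)
  moreover have "rec_nat 0 (\<lambda>_ r. 1 - r) m = m mod 2" for m :: nat
    by (induction m) (auto simp: mod_Suc)
  ultimately show ?thesis by simp
qed

definition decidable :: "(nat \<Rightarrow> bool) \<Rightarrow> bool" where
  "decidable P \<longleftrightarrow> computable (\<lambda>x. of_bool (P x))"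

lemma decidable_compose: "decidable P \<Longrightarrow> computable f \<Longrightarrow> decidable (\<lambda>x. P (f x))"
  unfolding decidable_def by (rule computable_compose)

lemma decidable_le:
  assumes "computable f" "computable g" shows "decidable (\<lambda>x. f x \<le> g x)"
proof -
  have "computable (\<lambda>x. 1 - (f x - g x))"
    by (intro computable_diff computable_const assms)
  moreover have "1 - (f x - g x) = of_bool (f x \<le> g x)" for x by auto
  ultimately show ?thesis by (simp add: decidable_def)
qed

lemma decidable_not:
  assumes "decidable P" shows "decidable (\<lambda>x. \<not> P x)"
proof -
  have "computable (\<lambda>x. 1 - of_bool (P x))"
    using assms by (intro computable_diff computable_const) (simp add: decidable_def)
  moreover have "1 - of_bool (P x) = (of_bool (\<not> P x) :: nat)" for x by simp
  ultimately show ?thesis by (simp add: decidable_def)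
qed

lemma decidable_conj: "decidable P \<Longrightarrow> decidable Q \<Longrightarrow> decidable (\<lambda>x. P x \<and> Q x)"
  using computable_mult[of "\<lambda>x. of_bool (P x)" "\<lambda>x. of_bool (Q x)"]
  by (simp add: decidable_def of_bool_conj)

lemma decidable_disj: "decidable P \<Longrightarrow> decidable Q \<Longrightarrow> decidable (\<lambda>x. P x \<or> Q x)"
  using decidable_not[OF decidable_conj[OF decidable_not decidable_not, of P Q]] by simp

lemma decidable_less:
  assumes "computable f" "computable g" shows "decidable (\<lambda>x. f x < g x)"
  using decidable_not[OF decidable_le[OF assms(2,1)]] by (simp add: not_le)

lemma decidable_eq:
  assumes "computable f" "computable g" shows "decidable (\<lambda>x. f x = g x)"
  using decidable_conj[OF decidable_le[OF assms] decidable_le[OF assms(2,1)]]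
  by (simp add: eq_iff)

lemma computable_if:
  assumes "decidable P" "computable f" "computable g"
  shows "computable (\<lambda>x. if P x then f x else g x)"
proof -
  have "computable (\<lambda>x. of_bool (P x) * f x + of_bool (\<not> P x) * g x)"
    using assms(1) decidable_not[OF assms(1)]
    by (intro computable_add computable_mult assms(2,3)) (simp_all add: decidable_def)
  moreover have "of_bool (P x) * f x + of_bool (\<not> P x) * g x = (if P x then f x else g x)" for x
    by simp
  ultimately show ?thesis by simp
qed

lemma computable_Least:
  assumes "decidable (\<lambda>z. P (pfst z) (psnd z))" "\<And>x. \<exists>k. P k x"
  shows "computable (\<lambda>x. LEAST k. P k x)"
proof -
  have "computable (\<lambda>x. LEAST k. (\<lambda>z. of_bool (\<not> P (pfst z) (psnd z))) (pair k x) = (0::nat))"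
    using decidable_not[OF assms(1)] assms(2)
    by (intro computable_Least_zero) (auto simp: decidable_def)
  then show ?thesis by simp
qed

text \<open>
  Bounded quantification is a terminating search for a counterexample, stopped at the bound.
\<close>

lemma decidable_all_less:
  assumes "decidable (\<lambda>z. P (pfst z) (psnd z))" "computable h"
  shows "decidable (\<lambda>x. \<forall>k<h x. P k x)"
proof -
  have "computable (\<lambda>x. LEAST k. \<not> P k x \<or> k = h x)"
    by (intro computable_Least decidable_disj decidable_not assms decidable_eq computable_pfst
        computable_psnd computable_ident computable_compose[OF assms(2)]) auto
  then have "decidable (\<lambda>x. (LEAST k. \<not> P k x \<or> k = h x) = h x)"
    by (intro decidable_eq assms)
  moreover have "(LEAST k. \<not> P k x \<or> k = h x) = h x \<longleftrightarrow> (\<forall>k<h x. P k x)" for x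
  proof
    assume "(LEAST k. \<not> P k x \<or> k = h x) = h x"
    then show "\<forall>k<h x. P k x" by (metis not_less_Least)
  next
    assume "\<forall>k<h x. P k x"
    then show "(LEAST k. \<not> P k x \<or> k = h x) = h x" by (intro Least_equality) (auto simp: not_less[symmetric])
  qed
  ultimately show ?thesis by simp
qed

lemma decidable_finite: "finite A \<Longrightarrow> decidable (\<lambda>x. x \<in> A)"
proof (induction A rule: finite_induct)
  case empty
  then show ?case using computable_const[of 0] by (simp add: decidable_def)
next
  case (insert a A)
  have "decidable (\<lambda>x. x = a \<or> x \<in> A)"
    by (intro decidable_disj decidable_eq computable_ident computable_const insert.IH)
  then show ?case by simp
qed

text \<open>
  The projective form of enumerability: unlike \<open>ce_set\<close>, it needs no case distinction for the empty
  set and is visibly closed under the logical connectives.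
\<close>

definition ce_pred :: "(nat \<Rightarrow> bool) \<Rightarrow> bool" where
  "ce_pred P \<longleftrightarrow> (\<exists>D. decidable D \<and> (\<forall>x. P x \<longleftrightarrow> (\<exists>w. D (pair w x))))"

lemma ce_predI:
  assumes "decidable (\<lambda>z. D (pfst z) (psnd z))" "\<And>x. P x \<longleftrightarrow> (\<exists>w. D w x)"
  shows "ce_pred P"
  unfolding ce_pred_def using assms by (intro exI[of _ "\<lambda>z. D (pfst z) (psnd z)"]) auto

lemma ce_predD:
  assumes "ce_pred P"
  shows "\<exists>D. decidable (\<lambda>z. D (pfst z) (psnd z)) \<and> (\<forall>x. P x \<longleftrightarrow> (\<exists>w. D w x))"
proof -
  from assms obtain D where "decidable D" "\<And>x. P x \<longleftrightarrow> (\<exists>w. D (pair w x))"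
    unfolding ce_pred_def by blast
  then show ?thesis by (intro exI[of _ "\<lambda>w x. D (pair w x)"]) auto
qed

lemma ce_decidable: "decidable P \<Longrightarrow> ce_pred P"
  by (rule ce_predI[of "\<lambda>_ x. P x"]) (simp_all add: decidable_compose computable_psnd computable_ident)

lemma ce_compose:
  assumes "ce_pred P" "computable f" shows "ce_pred (\<lambda>x. P (f x))"
proof -
  obtain D where D: "decidable (\<lambda>z. D (pfst z) (psnd z))" "\<And>x. P x \<longleftrightarrow> (\<exists>w. D w x)"
    using ce_predD[OF assms(1)] by blast
  have "decidable (\<lambda>z. (\<lambda>z. D (pfst z) (psnd z)) (pair (pfst z) (f (psnd z))))"
    by (rule decidable_compose[OF D(1)])
      (intro computable_pair computable_compose[OF assms(2)] computable_pfst computable_psnd computable_ident)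
  then show ?thesis using D(2) by (intro ce_predI[of "\<lambda>w x. D w (f x)"]) simp_all
qed

lemma ce_ex:
  assumes "ce_pred (\<lambda>z. P (pfst z) (psnd z))" shows "ce_pred (\<lambda>x. \<exists>k. P k x)"
proof -
  obtain D where D: "decidable (\<lambda>z. D (pfst z) (psnd z))"
      "\<And>x. P (pfst x) (psnd x) \<longleftrightarrow> (\<exists>w. D w x)"
    using ce_predD[OF assms] by blast
  have P: "P k x \<longleftrightarrow> (\<exists>w. D w (pair k x))" for k x using D(2)[of "pair k x"] by simp
  have "decidable (\<lambda>z. (\<lambda>z. D (pfst z) (psnd z)) (pair (pfst (pfst z)) (pair (psnd (pfst z)) (psnd z))))"
    by (rule decidable_compose[OF D(1)])
      (intro computable_pair computable_pfst computable_psnd computable_ident)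
  moreover have "(\<exists>k. P k x) \<longleftrightarrow> (\<exists>v. D (pfst v) (pair (psnd v) x))" for x
    unfolding P by (metis pfst_pair psnd_pair)
  ultimately show ?thesis
    by (intro ce_predI[of "\<lambda>v x. D (pfst v) (pair (psnd v) x)"]) simp_all
qed

lemma ce_conj:
  assumes "ce_pred P" "ce_pred Q" shows "ce_pred (\<lambda>x. P x \<and> Q x)"
proof -
  obtain D where D: "decidable (\<lambda>z. D (pfst z) (psnd z))" "\<And>x. P x \<longleftrightarrow> (\<exists>w. D w x)"
    using ce_predD[OF assms(1)] by blast
  obtain E where E: "decidable (\<lambda>z. E (pfst z) (psnd z))" "\<And>x. Q x \<longleftrightarrow> (\<exists>w. E w x)"
    using ce_predD[OF assms(2)] by blast
  have "decidable (\<lambda>z. (\<lambda>z. D (pfst z) (psnd z)) (pair (pfst (pfst z)) (psnd z))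
      \<and> (\<lambda>z. E (pfst z) (psnd z)) (pair (psnd (pfst z)) (psnd z)))"
    by (intro decidable_conj decidable_compose[OF D(1)] decidable_compose[OF E(1)])
      (intro computable_pair computable_pfst computable_psnd computable_ident)+
  moreover have "P x \<and> Q x \<longleftrightarrow> (\<exists>v. D (pfst v) x \<and> E (psnd v) x)" for x
    unfolding D(2) E(2) by (metis pfst_pair psnd_pair)
  ultimately show ?thesis
    by (intro ce_predI[of "\<lambda>v x. D (pfst v) x \<and> E (psnd v) x"]) simp_all
qed

lemma ce_disj:
  assumes "ce_pred P" "ce_pred Q" shows "ce_pred (\<lambda>x. P x \<or> Q x)"
proof -
  obtain D where D: "decidable (\<lambda>z. D (pfst z) (psnd z))" "\<And>x. P x \<longleftrightarrow> (\<exists>w. D w x)"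
    using ce_predD[OF assms(1)] by blast
  obtain E where E: "decidable (\<lambda>z. E (pfst z) (psnd z))" "\<And>x. Q x \<longleftrightarrow> (\<exists>w. E w x)"
    using ce_predD[OF assms(2)] by blast
  show ?thesis
    by (rule ce_predI[OF decidable_disj[OF D(1) E(1)]]) (auto simp: D(2) E(2))
qed

lemmas computable_intros =
  computable_ident computable_const computable_Suc_comp computable_add computable_mult
  computable_diff computable_pair computable_pfst computable_psnd computable_power2
  computable_mod2 computable_if

lemmas decidable_intros =
  decidable_not decidable_conj decidable_disj decidable_le decidable_less decidable_eq

text \<open>
  Post's theorem: search for a witness of either side; one of them exists.
\<close>

lemma decidable_if_ce_and_co_ce:
  assumes "ce_pred P" "ce_pred (\<lambda>x. \<not> P x)" shows "decidable P"
proof -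
  obtain D where D: "decidable (\<lambda>z. D (pfst z) (psnd z))" "\<And>x. P x \<longleftrightarrow> (\<exists>w. D w x)"
    using ce_predD[OF assms(1)] by blast
  obtain E where E: "decidable (\<lambda>z. E (pfst z) (psnd z))" "\<And>x. (\<not> P x) = (\<exists>w. E w x)"
    using ce_predD[OF assms(2)] by blast
  have ex: "\<exists>w. D w x \<or> E w x" for x using D(2)[of x] E(2)[of x] by blast
  then have least: "computable (\<lambda>x. LEAST w. D w x \<or> E w x)"
    by (intro computable_Least decidable_disj D E) auto
  have "decidable (\<lambda>x. (\<lambda>z. D (pfst z) (psnd z)) (pair (LEAST w. D w x \<or> E w x) x))"
    by (intro decidable_compose[OF D(1)] computable_pair least computable_ident)
  then have dec: "decidable (\<lambda>x. D (LEAST w. D w x \<or> E w x) x)" by simp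
  have "(\<lambda>x. D (LEAST w. D w x \<or> E w x) x) = P"
    using LeastI_ex[OF ex] D(2) E(2) by (intro ext) blast
  with dec show ?thesis by simp
qed

lemma ce_pred_of_ce_set:
  assumes "ce_set A" shows "ce_pred (\<lambda>x. x \<in> A)"
proof (cases "A = {}")
  case True
  then show ?thesis using ce_decidable[OF decidable_finite[of "{}"]] by simp
next
  case False
  then obtain f where f: "computable f" "A = range f" using assms unfolding ce_set_def by blast
  show ?thesis
    by (rule ce_predI[of "\<lambda>w x. x = f w"])
      (use f(2) in \<open>auto intro!: decidable_intros computable_intros computable_compose[OF f(1)]\<close>)
qed

lemma ce_set_of_ce_pred:
  assumes "ce_pred P" shows "ce_set {x. P x}"
proof (cases "\<exists>x. P x")
  case True
  then obtain x0 where "P x0" by blast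
  obtain D where D: "decidable (\<lambda>z. D (pfst z) (psnd z))" "\<And>x. P x \<longleftrightarrow> (\<exists>w. D w x)"
    using ce_predD[OF assms] by blast
  define f where "f z = (if D (pfst z) (psnd z) then psnd z else x0)" for z
  have "computable f" unfolding f_def by (intro computable_intros D(1))
  moreover have "{x. P x} = range f"
  proof
    show "range f \<subseteq> {x. P x}" using \<open>P x0\<close> D(2) by (auto simp: f_def)
    show "{x. P x} \<subseteq> range f"
    proof
      fix x assume "x \<in> {x. P x}"
      then obtain w where "D w x" using D(2) by blast
      then have "x = f (pair w x)" by (simp add: f_def)
      then show "x \<in> range f" by blast
    qed
  qed
  ultimately show ?thesis unfolding ce_set_def by blast
qed (simp add: ce_set_def)

section \<open>Closure under a c.e. rule\<close>

text \<open>
  The number \<open>0\<close> is the only axiom.  It serves as a dummy premise, so that rules with fewer than two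
  premises, in particular further axioms, fit the same format.
\<close>

inductive gen :: "(nat \<Rightarrow> nat \<Rightarrow> nat \<Rightarrow> bool) \<Rightarrow> nat \<Rightarrow> bool" for R where
  gen_zero: "gen R 0"
| gen_step: "gen R x \<Longrightarrow> gen R y \<Longrightarrow> R x y z \<Longrightarrow> gen R z"

text \<open>
  Derivations are trees, coded by numbers above those of their subtrees: the successor of
  \<open>pair (pair w z) (pair i j)\<close> stands for the tree that derives \<open>z\<close> from the conclusions of the trees
  \<open>i\<close> and \<open>j\<close>, where \<open>w\<close> is a witness that the rule applies.  If the witness is wrong, the tree is
  counted as the axiom.  This is a course-of-values recursion; it is reduced to primitive
  recursion by carrying along the list of all earlier values, stored in nested pairs.
\<close>

lemma gen_enumeration:
  assumes "ce_pred (\<lambda>t. R (pfst t) (pfst (psnd t)) (psnd (psnd t)))"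
  obtains h where "computable h" "\<And>t. gen R t \<longleftrightarrow> (\<exists>n. h n = t)"
proof -
  obtain D where D: "decidable (\<lambda>z. D (pfst z) (psnd z))"
    "\<And>t. R (pfst t) (pfst (psnd t)) (psnd (psnd t)) \<longleftrightarrow> (\<exists>w. D w t)"
    using ce_predD[OF assms] by blast
  have R: "R x y z \<longleftrightarrow> (\<exists>w. D w (pair x (pair y z)))" for x y z
    using D(2)[of "pair x (pair y z)"] by simp
  \<comment> \<open>The history \<open>H n\<close> has the \<open>n\<close>-th value in front and \<open>H (n - 1)\<close> behind it, so \<open>m\<close> steps of
    \<open>psnd\<close> lead from \<open>H (m + i)\<close> back to \<open>H i\<close>.\<close>
  define peel where "peel m r = rec_nat r (\<lambda>_ s. psnd s) m" for m r
  have peel: "computable (\<lambda>x. peel (f x) (a x))" if "computable f" "computable a" for f a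
    unfolding peel_def by (intro computable_rec computable_intros that)
  define item where "item k i r = pfst (peel (k - i) r)" for k i r
  have item: "computable (\<lambda>x. item (k x) (i x) (r x))"
    if "computable k" "computable i" "computable r" for k i r
    unfolding item_def by (intro computable_intros peel that)
  define nxt where "nxt k r =
    (if D (pfst (pfst k)) (pair (item k (pfst (psnd k)) r)
          (pair (item k (psnd (psnd k)) r) (psnd (pfst k))))
     then psnd (pfst k) else 0)" for k r
  define H where "H n = rec_nat (pair 0 0) (\<lambda>k r. pair (nxt k r) r) n" for n
  have H0: "H 0 = pair 0 0" and HSuc: "H (Suc k) = pair (nxt k (H k)) (H k)" for k
    by (simp_all add: H_def)
  have "decidable (\<lambda>z. (\<lambda>z. D (pfst z) (psnd z)) (pair (a z) (b z)))"
    if "computable a" "computable b" for a b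
    by (intro decidable_compose[OF D(1)] computable_intros that)
  then have D': "decidable (\<lambda>z. D (a z) (b z))" if "computable a" "computable b" for a b
    using that by simp
  have "computable H"
    unfolding H_def nxt_def by (intro computable_rec computable_intros D' item)
  then have comp: "computable (\<lambda>n. pfst (H n))" by (rule computable_pfst)
  have peel_Suc: "peel (Suc m) r = psnd (peel m r)" for m r by (simp add: peel_def)
  have peel_H: "peel m (H (m + i)) = H i" for m i
  proof (induction m arbitrary: i)
    case 0
    then show ?case by (simp add: peel_def)
  next
    case (Suc m)
    from Suc[of "Suc i"] show ?case by (simp add: peel_Suc HSuc)
  qed
  have item_H: "item k i (H k) = pfst (H i)" if "i \<le> k" for k i
    using peel_H[of "k - i" i] that by (simp add: item_def)
  have nxt_H: "nxt (pair (pair w z) (pair i j)) (H (pair (pair w z) (pair i j))) =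
     (if D w (pair (pfst (H i)) (pair (pfst (H j)) z)) then z else 0)" for w z i j
  proof -
    have "i \<le> pair (pair w z) (pair i j)" "j \<le> pair (pair w z) (pair i j)"
      using le_pair_1 le_pair_2 le_trans by metis+
    then show ?thesis by (simp add: nxt_def item_H)
  qed
  have "gen R t \<longleftrightarrow> (\<exists>n. pfst (H n) = t)" for t
  proof
    assume "gen R t"
    then show "\<exists>n. pfst (H n) = t"
    proof induction
      case gen_zero
      show ?case by (rule exI[of _ 0]) (simp add: H0)
    next
      case (gen_step x y z)
      then obtain i j w where "pfst (H i) = x" "pfst (H j) = y" "D w (pair x (pair y z))"
        unfolding R by blast
      then show ?case
        by (intro exI[of _ "Suc (pair (pair w z) (pair i j))"]) (simp add: HSuc nxt_H)
    qed
  next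
    have "gen R (pfst (H n))" for n
    proof (induction n rule: less_induct)
      case (less n)
      show ?case
      proof (cases n)
        case 0
        then show ?thesis by (simp add: H0 gen_zero)
      next
        case (Suc k)
        obtain w z i j where k: "k = pair (pair w z) (pair i j)" by (metis pair_proj)
        have "i < n" "j < n"
          using Suc k le_pair_1 le_pair_2 le_trans le_imp_less_Suc by metis+
        then have "gen R (pfst (H i))" "gen R (pfst (H j))" using less by blast+
        then have "D w (pair (pfst (H i)) (pair (pfst (H j)) z)) \<Longrightarrow> gen R z"
          using R by (blast intro: gen.gen_step)
        then show ?thesis
          unfolding Suc HSuc unfolding k nxt_H using gen.gen_zero[of R] by simp
      qed
    qed
    then show "\<exists>n. pfst (H n) = t \<Longrightarrow> gen R t" by blast
  qed
  with comp show thesis by (rule that)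
qed

lemma ce_gen:
  assumes "ce_pred (\<lambda>t. R (pfst t) (pfst (psnd t)) (psnd (psnd t)))"
  shows "ce_pred (gen R)"
proof -
  obtain h where h: "computable h" "\<And>t. gen R t \<longleftrightarrow> (\<exists>n. h n = t)"
    using gen_enumeration[OF assms] by blast
  show ?thesis
    by (rule ce_predI[of "\<lambda>n t. h n = t"])
      (use h(2) in \<open>auto intro!: decidable_intros computable_intros computable_compose[OF h(1)]\<close>)
qed

section \<open>A universal c.e. set\<close>

text \<open>
  Programs are numbers.  Arguments and values are numbers too, so that the clauses below form a
  rule on numbers.  \<open>p_nz p\<close> checks that \<open>p\<close> has only positive values below a given bound, which is
  the part of minimisation that needs a recursion; \<open>p_fail\<close> has no clause at all and thereby
  represents the empty set.
\<close>

definition p_zero :: nat where "p_zero = pair 0 0"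
definition p_succ :: nat where "p_succ = pair 1 0"
definition p_fst :: nat where "p_fst = pair 2 0"
definition p_snd :: nat where "p_snd = pair 3 0"
definition p_comp :: "nat \<Rightarrow> nat \<Rightarrow> nat" where "p_comp p q = pair 4 (pair p q)"
definition p_pair :: "nat \<Rightarrow> nat \<Rightarrow> nat" where "p_pair p q = pair 5 (pair p q)"
definition p_rec :: "nat \<Rightarrow> nat \<Rightarrow> nat" where "p_rec p q = pair 6 (pair p q)"
definition p_nz :: "nat \<Rightarrow> nat" where "p_nz p = pair 7 p"
definition p_mu :: "nat \<Rightarrow> nat" where "p_mu p = pair 8 p"
definition p_fail :: nat where "p_fail = pair 9 0"

lemmas p_defs = p_zero_def p_succ_def p_fst_def p_snd_def p_comp_def p_pair_def p_rec_def
  p_nz_def p_mu_def p_fail_def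

inductive ev :: "nat \<Rightarrow> nat \<Rightarrow> nat \<Rightarrow> bool" where
  ev_zero: "ev p_zero x 0"
| ev_succ: "ev p_succ x (Suc x)"
| ev_fst: "ev p_fst x (pfst x)"
| ev_snd: "ev p_snd x (psnd x)"
| ev_comp: "ev q x y \<Longrightarrow> ev p y z \<Longrightarrow> ev (p_comp p q) x z"
| ev_pair: "ev p x y \<Longrightarrow> ev q x z \<Longrightarrow> ev (p_pair p q) x (pair y z)"
| ev_rec_0: "ev p x y \<Longrightarrow> ev (p_rec p q) (pair 0 x) y"
| ev_rec_Suc: "ev (p_rec p q) (pair k x) r \<Longrightarrow> ev q (pair k (pair r x)) z \<Longrightarrow>
    ev (p_rec p q) (pair (Suc k) x) z"
| ev_nz_0: "ev (p_nz p) (pair 0 x) 0"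
| ev_nz_Suc: "ev (p_nz p) (pair k x) 0 \<Longrightarrow> ev p (pair k x) (Suc y) \<Longrightarrow>
    ev (p_nz p) (pair (Suc k) x) 0"
| ev_mu: "ev (p_nz p) (pair k x) 0 \<Longrightarrow> ev p (pair k x) 0 \<Longrightarrow> ev (p_mu p) x k"

lemma p_eq_iff [simp]:
  "p_comp p q = p_comp p' q' \<longleftrightarrow> p = p' \<and> q = q'"
  "p_pair p q = p_pair p' q' \<longleftrightarrow> p = p' \<and> q = q'"
  "p_rec p q = p_rec p' q' \<longleftrightarrow> p = p' \<and> q = q'"
  "p_nz p = p_nz p' \<longleftrightarrow> p = p'"
  "p_mu p = p_mu p' \<longleftrightarrow> p = p'"
  by (simp_all add: p_defs)

lemma ev_zero_iff [simp]: "ev p_zero x y \<longleftrightarrow> y = 0"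
  and ev_succ_iff [simp]: "ev p_succ x y \<longleftrightarrow> y = Suc x"
  and ev_fst_iff [simp]: "ev p_fst x y \<longleftrightarrow> y = pfst x"
  and ev_snd_iff [simp]: "ev p_snd x y \<longleftrightarrow> y = psnd x"
  and ev_comp_iff [simp]: "ev (p_comp p q) x z \<longleftrightarrow> (\<exists>y. ev q x y \<and> ev p y z)"
  and ev_pair_iff [simp]: "ev (p_pair p q) x v \<longleftrightarrow> (\<exists>y z. v = pair y z \<and> ev p x y \<and> ev q x z)"
  and ev_rec_0_iff [simp]: "ev (p_rec p q) (pair 0 x) y \<longleftrightarrow> ev p x y"
  and ev_rec_Suc_iff [simp]: "ev (p_rec p q) (pair (Suc k) x) z \<longleftrightarrow>
    (\<exists>r. ev (p_rec p q) (pair k x) r \<and> ev q (pair k (pair r x)) z)"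
  and ev_nz_0_iff [simp]: "ev (p_nz p) (pair 0 x) y \<longleftrightarrow> y = 0"
  and ev_nz_Suc_iff [simp]: "ev (p_nz p) (pair (Suc k) x) z \<longleftrightarrow>
    z = 0 \<and> ev (p_nz p) (pair k x) 0 \<and> (\<exists>y. ev p (pair k x) (Suc y))"
  and ev_mu_iff [simp]: "ev (p_mu p) x k \<longleftrightarrow> ev (p_nz p) (pair k x) 0 \<and> ev p (pair k x) 0"
  and ev_fail_iff [simp]: "\<not> ev p_fail x y"
  by (subst ev.simps, force simp: p_defs)+

text \<open>
  The successor keeps \<open>0\<close> free for the dummy premise of \<open>gen\<close>.
\<close>

definition ev_fact :: "nat \<Rightarrow> nat \<Rightarrow> nat \<Rightarrow> nat" where
  "ev_fact p x y = Suc (pair p (pair x y))"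

lemma ev_fact_eq_iff [simp]: "ev_fact p x y = ev_fact p' x' y' \<longleftrightarrow> p = p' \<and> x = x' \<and> y = y'"
  and ev_fact_neq_0 [simp]: "ev_fact p x y \<noteq> 0" "0 \<noteq> ev_fact p x y"
  by (simp_all add: ev_fact_def)

definition ev_rule :: "nat \<Rightarrow> nat \<Rightarrow> nat \<Rightarrow> bool" where
  "ev_rule a b c \<longleftrightarrow>
    (\<exists>x. c = ev_fact p_zero x 0) \<or>
    (\<exists>x. c = ev_fact p_succ x (Suc x)) \<or>
    (\<exists>x. c = ev_fact p_fst x (pfst x)) \<or>
    (\<exists>x. c = ev_fact p_snd x (psnd x)) \<or>
    (\<exists>p q x y z. a = ev_fact q x y \<and> b = ev_fact p y z \<and> c = ev_fact (p_comp p q) x z) \<or>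
    (\<exists>p q x y z. a = ev_fact p x y \<and> b = ev_fact q x z \<and> c = ev_fact (p_pair p q) x (pair y z)) \<or>
    (\<exists>p q x y. a = ev_fact p x y \<and> c = ev_fact (p_rec p q) (pair 0 x) y) \<or>
    (\<exists>p q k x r z. a = ev_fact (p_rec p q) (pair k x) r \<and> b = ev_fact q (pair k (pair r x)) z \<and>
       c = ev_fact (p_rec p q) (pair (Suc k) x) z) \<or>
    (\<exists>p x. c = ev_fact (p_nz p) (pair 0 x) 0) \<or>
    (\<exists>p k x y. a = ev_fact (p_nz p) (pair k x) 0 \<and> b = ev_fact p (pair k x) (Suc y) \<and>
       c = ev_fact (p_nz p) (pair (Suc k) x) 0) \<or>
    (\<exists>p k x. a = ev_fact (p_nz p) (pair k x) 0 \<and> b = ev_fact p (pair k x) 0 \<and>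
       c = ev_fact (p_mu p) x k)"

text \<open>
  Every clause of \<open>ev\<close> has at most two premises, so evaluation is an instance of \<open>gen\<close>; this makes
  it c.e. without any analysis of computations.
\<close>

lemma ev_iff_gen: "ev p x y \<longleftrightarrow> gen ev_rule (ev_fact p x y)"
proof
  assume "ev p x y"
  then show "gen ev_rule (ev_fact p x y)"
  proof induction
    case (ev_zero x)
    then show ?case
      by (rule_tac gen_step[OF gen_zero gen_zero]) (simp add: ev_rule_def)
  next
    case (ev_succ x)
    then show ?case
      by (rule_tac gen_step[OF gen_zero gen_zero]) (simp add: ev_rule_def)
  next
    case (ev_fst x)
    then show ?case
      by (rule_tac gen_step[OF gen_zero gen_zero]) (simp add: ev_rule_def)
  next
    case (ev_snd x)
    then show ?case
      by (rule_tac gen_step[OF gen_zero gen_zero]) (simp add: ev_rule_def)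
  next
    case (ev_comp q x y p z)
    show ?case
      by (rule gen_step[OF ev_comp.IH]) (simp add: ev_rule_def)
  next
    case (ev_pair p x y q z)
    show ?case
      by (rule gen_step[OF ev_pair.IH]) (simp add: ev_rule_def)
  next
    case (ev_rec_0 p x y q)
    show ?case
      by (rule gen_step[OF ev_rec_0.IH gen_zero]) (simp add: ev_rule_def)
  next
    case (ev_rec_Suc p q k x r z)
    show ?case
      by (rule gen_step[OF ev_rec_Suc.IH]) (simp add: ev_rule_def)
  next
    case (ev_nz_0 p x)
    then show ?case
      by (rule_tac gen_step[OF gen_zero gen_zero]) (simp add: ev_rule_def)
  next
    case (ev_nz_Suc p k x y)
    show ?case
      by (rule gen_step[OF ev_nz_Suc.IH]) (simp add: ev_rule_def)
  next
    case (ev_mu p k x)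
    show ?case
      by (rule gen_step[OF ev_mu.IH]) (simp add: ev_rule_def)
  qed
next
  have "\<forall>p x y. t = ev_fact p x y \<longrightarrow> ev p x y" if "gen ev_rule t" for t
    using that
  proof induction
    case (gen_step a b c)
    from gen_step.hyps(3) show ?case
      unfolding ev_rule_def by (elim disjE exE conjE) (use gen_step.IH in auto)
  qed simp
  then show "gen ev_rule (ev_fact p x y) \<Longrightarrow> ev p x y" by blast
qed

lemma ce_eq: "computable f \<Longrightarrow> computable g \<Longrightarrow> ce_pred (\<lambda>x. f x = g x)"
  by (intro ce_decidable decidable_eq)

lemma ce_ev:
  assumes "computable a" "computable b" "computable c"
  shows "ce_pred (\<lambda>t. ev (a t) (b t) (c t))"
proof -
  have "ce_pred (gen ev_rule)"
    by (rule ce_gen, unfold ev_rule_def ev_fact_def p_defs)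
      (intro ce_disj ce_conj ce_ex ce_eq computable_intros)
  then show ?thesis
    unfolding ev_iff_gen ev_fact_def by (rule ce_compose) (intro computable_intros assms)
qed

primrec list_code :: "nat list \<Rightarrow> nat" where
  "list_code [] = 0"
| "list_code (x # xs) = pair x (list_code xs)"

lemma ev_projection:
  "\<exists>p. \<forall>xs. i < length xs \<longrightarrow> (\<forall>y. ev p (list_code xs) y \<longleftrightarrow> y = xs ! i)"
proof (induction i)
  case 0
  have "ev p_fst (list_code xs) y \<longleftrightarrow> y = xs ! 0" if "0 < length xs" for xs y
    using that by (cases xs) auto
  then show ?case by blast
next
  case (Suc i)
  then obtain p where p: "\<And>xs y. i < length xs \<Longrightarrow> ev p (list_code xs) y \<longleftrightarrow> y = xs ! i"
    by blast
  have "ev (p_comp p p_snd) (list_code xs) y \<longleftrightarrow> y = xs ! Suc i" if "Suc i < length xs" for xs y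
    using that p by (cases xs) auto
  then show ?case by blast
qed

text \<open>
  Each of Kleene's schemes is matched by a program constructor.  A function of \<open>n\<close> variables becomes
  a program on codes of lists; composition with several functions builds the code of the list of
  their values by repeated pairing.
\<close>

lemma ev_recursive_fn:
  "recursive_fn n f \<Longrightarrow>
    \<exists>p. \<forall>xs. length xs = n \<longrightarrow> (\<forall>y. ev p (list_code xs) y \<longleftrightarrow> y = f xs)"
proof (induction rule: recursive_fn.induct)
  case (zero n)
  then show ?case by (intro exI[of _ p_zero]) simp
next
  case succ
  have "ev (p_comp p_succ p_fst) (list_code xs) y \<longleftrightarrow> y = Suc (hd xs)" if "length xs = 1" for xs y
    using that by (cases xs) auto
  then show ?case by blast
next
  case (proj i n)
  then show ?case using ev_projection[of i] by blast
next
  case (comp gs f n)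
  then obtain p where p: "\<And>ys y. length ys = length gs \<Longrightarrow> ev p (list_code ys) y \<longleftrightarrow> y = f ys"
    by blast
  have "\<forall>g\<in>set gs. \<exists>p. \<forall>xs. length xs = n \<longrightarrow> (\<forall>y. ev p (list_code xs) y \<longleftrightarrow> y = g xs)"
    using comp.IH(2) by blast
  then have "\<exists>q. \<forall>xs. length xs = n \<longrightarrow>
      (\<forall>y. ev q (list_code xs) y \<longleftrightarrow> y = list_code (map (\<lambda>g. g xs) gs))"
  proof (induction gs)
    case Nil
    show ?case by (intro exI[of _ p_zero]) simp
  next
    case (Cons g gs)
    then obtain q where q: "\<And>xs y. length xs = n \<Longrightarrow>
        ev q (list_code xs) y \<longleftrightarrow> y = list_code (map (\<lambda>g. g xs) gs)" by auto
    have "\<exists>r. \<forall>xs. length xs = n \<longrightarrow> (\<forall>y. ev r (list_code xs) y \<longleftrightarrow> y = g xs)"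
      using Cons.prems by simp
    then obtain r where r: "\<And>xs y. length xs = n \<Longrightarrow> ev r (list_code xs) y \<longleftrightarrow> y = g xs"
      by blast
    show ?case by (intro exI[of _ "p_pair r q"]) (simp add: q r)
  qed
  then obtain q where q: "\<And>xs y. length xs = n \<Longrightarrow>
      ev q (list_code xs) y \<longleftrightarrow> y = list_code (map (\<lambda>g. g xs) gs)" by blast
  show ?case by (intro exI[of _ "p_comp p q"]) (simp add: p q)
next
  case (prim_rec n f g)
  then obtain p q where
    p: "\<And>xs y. length xs = n \<Longrightarrow> ev p (list_code xs) y \<longleftrightarrow> y = f xs" and
    q: "\<And>xs y. length xs = Suc (Suc n) \<Longrightarrow> ev q (list_code xs) y \<longleftrightarrow> y = g xs" by blast
  have "ev (p_rec p q) (pair m (list_code ys)) y \<longleftrightarrow>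
      y = rec_nat (f ys) (\<lambda>k r. g (k # r # ys)) m" if "length ys = n" for m ys y
  proof (induction m arbitrary: y)
    case 0
    then show ?case using p that by simp
  next
    case (Suc m)
    then show ?case using q[of "m # _ # ys"] that by simp
  qed
  then have "ev (p_rec p q) (list_code xs) y \<longleftrightarrow>
      y = rec_nat (f (tl xs)) (\<lambda>k r. g (k # r # tl xs)) (hd xs)" if "length xs = Suc n" for xs y
    using that by (cases xs) auto
  then show ?case by blast
next
  case (mu n f)
  then obtain p where p: "\<And>xs y. length xs = Suc n \<Longrightarrow> ev p (list_code xs) y \<longleftrightarrow> y = f xs"
    by blast
  have "ev (p_mu p) (list_code xs) k \<longleftrightarrow> k = (LEAST k. f (k # xs) = 0)" if xs: "length xs = n" for xs k
  proof -
    have p': "ev p (pair m (list_code xs)) y \<longleftrightarrow> y = f (m # xs)" for m y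
      using p[of "m # xs"] xs by simp
    have Suc_ex: "(\<exists>y. Suc y = v) \<longleftrightarrow> v \<noteq> 0" for v by (cases v) auto
    have nz: "ev (p_nz p) (pair m (list_code xs)) 0 \<longleftrightarrow> (\<forall>j<m. f (j # xs) \<noteq> 0)" for m
      by (induction m) (auto simp: p' Suc_ex less_Suc_eq)
    have ex: "\<exists>k. f (k # xs) = 0" using mu.hyps(2) xs by blast
    show ?thesis
    proof
      assume "ev (p_mu p) (list_code xs) k"
      then have "f (k # xs) = 0" "\<forall>j<k. f (j # xs) \<noteq> 0" by (auto simp: nz p')
      then show "k = (LEAST k. f (k # xs) = 0)"
        by (intro Least_equality[symmetric]) (auto simp: not_less[symmetric])
    next
      assume "k = (LEAST k. f (k # xs) = 0)"
      then show "ev (p_mu p) (list_code xs) k"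
        using LeastI_ex[OF ex] not_less_Least by (auto simp: nz p')
    qed
  qed
  then show ?case by blast
qed

text \<open>
  The enumeration theorem, with a decidable matrix: the search for a witness \<open>w\<close> can then be
  simulated stage by stage.
\<close>

lemma universal_ce_set:
  obtains D :: "nat \<Rightarrow> nat \<Rightarrow> nat \<Rightarrow> bool"
  where "decidable (\<lambda>z. D (pfst z) (pfst (psnd z)) (psnd (psnd z)))"
    and "\<And>A. ce_set A \<Longrightarrow> \<exists>e. \<forall>x. x \<in> A \<longleftrightarrow> (\<exists>w. D e x w)"
proof -
  have ce: "ce_pred (\<lambda>t. \<exists>w. ev (pfst t) (pair w 0) (psnd t))"
    by (intro ce_ex ce_ev computable_intros)
  then obtain D where D: "decidable (\<lambda>z. D (pfst z) (psnd z))"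
    "\<And>t. (\<exists>w. ev (pfst t) (pair w 0) (psnd t)) \<longleftrightarrow> (\<exists>w. D w t)"
    using ce_predD[OF ce] by blast
  have D': "(\<exists>w. D w (pair e y)) \<longleftrightarrow> (\<exists>w. ev e (pair w 0) y)" for e y
    using D(2)[of "pair e y"] by simp
  have "decidable (\<lambda>z. (\<lambda>z. D (pfst z) (psnd z))
      (pair (psnd (psnd z)) (pair (pfst z) (pfst (psnd z)))))"
    by (intro decidable_compose[OF D(1)] computable_intros)
  then have "decidable (\<lambda>z. D (psnd (psnd z)) (pair (pfst z) (pfst (psnd z))))" by simp
  moreover have "\<exists>e. \<forall>x. x \<in> A \<longleftrightarrow> (\<exists>w. D w (pair e x))" if A: "ce_set A" for A
  proof (cases "A = {}")
    case True
    then show ?thesis unfolding D' by (intro exI[of _ p_fail]) simp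
  next
    case False
    then obtain f where f: "computable f" "A = range f" using A unfolding ce_set_def by blast
    then obtain g where g: "recursive_fn 1 g" "\<And>x. f x = g [x]"
      unfolding computable_def by blast
    obtain p where p: "\<And>xs y. length xs = 1 \<Longrightarrow> ev p (list_code xs) y \<longleftrightarrow> y = g xs"
      using ev_recursive_fn[OF g(1)] by blast
    have "ev p (pair w 0) y \<longleftrightarrow> y = f w" for w y using p[of "[w]"] g(2) by simp
    then show ?thesis unfolding D' f(2) by blast
  qed
  ultimately show thesis by (rule that)
qed

section \<open>Computing with codes of strings\<close>

lemma string_code_append: "string_code (s @ t) = string_code s + 2 ^ length s * string_code t"
  by (induction s) (auto simp: algebra_simps)

lemma string_code_replicate:
  "string_code (replicate n b) = (if b then 2 else 1) * (2 ^ n - 1)"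
  by (induction n) (auto simp: algebra_simps)

text \<open>
  The codes of the strings of length \<open>l\<close> are exactly the numbers from \<open>2\<^sup>l - 1\<close> to \<open>2\<^sup>l\<^sup>+\<^sup>1 - 2\<close>,
  so the length can be read off the code.
\<close>

lemma string_code_bounds:
  "2 ^ length s \<le> Suc (string_code s)" "Suc (string_code s) < 2 ^ Suc (length s)"
  by (induction s) auto

lemma length_le_string_code: "length s \<le> string_code s"
  by (induction s) auto

definition slen :: "nat \<Rightarrow> nat" where "slen x = (LEAST l. Suc x < 2 ^ Suc l)"

lemma slen_string_code [simp]: "slen (string_code s) = length s"
  unfolding slen_def
proof (rule Least_equality)
  show "Suc (string_code s) < 2 ^ Suc (length s)" by (rule string_code_bounds)
  fix l assume "Suc (string_code s) < 2 ^ Suc l"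
  then have "(2::nat) ^ length s < 2 ^ Suc l" using string_code_bounds(1) le_less_trans by blast
  then have "length s < Suc l" by (rule power_less_imp_less_exp[rotated]) simp
  then show "length s \<le> l" by simp
qed

lemma computable_slen: "computable f \<Longrightarrow> computable (\<lambda>x. slen (f x))"
proof (rule computable_compose[of slen])
  have "\<exists>l. Suc x < 2 ^ Suc l" for x
    using less_exp[of "Suc x"] by (intro exI[of _ x])
  then show "computable slen"
    unfolding slen_def by (intro computable_Least decidable_intros computable_intros) 
qed

definition sapp :: "nat \<Rightarrow> nat \<Rightarrow> nat" where "sapp x y = x + 2 ^ slen x * y"

lemma sapp_string_code [simp]: "sapp (string_code s) (string_code t) = string_code (s @ t)"
  by (simp add: sapp_def string_code_append)

lemma computable_sapp: "computable f \<Longrightarrow> computable g \<Longrightarrow> computable (\<lambda>x. sapp (f x) (g x))"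
  unfolding sapp_def by (intro computable_intros computable_slen)

section \<open>Constructing 1-generic sets by finite extensions\<close>

text \<open>
  The string \<open>\<mu>\<close> decides \<open>V\<close>, while \<open>\<rho>\<close> may be longer in order to restore the invariant \<open>\<Phi>\<close>.  The
  universal set provides the list of all requirements; in the construction, step \<open>n\<close> treats the
  \<open>n\<close>-th section.
\<close>

lemma generic_from_extensions:
  assumes "\<Phi> []"
    and extend: "\<And>\<sigma> V. \<Phi> \<sigma> \<Longrightarrow> ce_strings V \<Longrightarrow>
      \<exists>\<rho> \<mu>. prefix \<sigma> \<mu> \<and> prefix \<mu> \<rho> \<and> \<Phi> \<rho> \<and> length \<sigma> < length \<rho> \<and>
        (\<mu> \<in> V \<or> \<not> (\<exists>\<tau>. prefix \<mu> \<tau> \<and> \<tau> \<in> V))"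
  obtains G where "one_generic G"
    and "\<And>n. \<exists>\<sigma>. initial_segment \<sigma> G \<and> n \<le> length \<sigma> \<and> \<Phi> \<sigma>"
proof -
  obtain D :: "nat \<Rightarrow> nat \<Rightarrow> nat \<Rightarrow> bool" where
    D: "\<And>A. ce_set A \<Longrightarrow> \<exists>e. \<forall>x. x \<in> A \<longleftrightarrow> (\<exists>w. D e x w)"
    using universal_ce_set by metis
  define V where "V e = {\<sigma>. \<exists>w. D e (string_code \<sigma>) w}" for e
  have V: "\<exists>e. W = V e" if "ce_strings W" for W
  proof -
    from that obtain e where e: "\<And>x. x \<in> string_code ` W \<longleftrightarrow> (\<exists>w. D e x w)"
      using D unfolding ce_strings_def by blast
    have "\<sigma> \<in> W \<longleftrightarrow> \<sigma> \<in> V e" for \<sigma>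
      using e[of "string_code \<sigma>"] inj_image_mem_iff[OF bij_is_inj[OF bij_string_code]]
      by (simp add: V_def)
    then show ?thesis by blast
  qed
  define Q where "Q n \<sigma> \<rho> \<longleftrightarrow> (\<exists>\<mu>. prefix \<sigma> \<mu> \<and> prefix \<mu> \<rho> \<and> length \<sigma> < length \<rho> \<and>
    (ce_strings (V n) \<longrightarrow> \<mu> \<in> V n \<or> \<not> (\<exists>\<tau>. prefix \<mu> \<tau> \<and> \<tau> \<in> V n)))" for n \<sigma> \<rho>
  have "\<exists>\<rho>. \<Phi> \<rho> \<and> Q n \<sigma> \<rho>" if "\<Phi> \<sigma>" for n \<sigma>
  proof (cases "ce_strings (V n)")
    case True
    then show ?thesis using extend[OF that True] unfolding Q_def by blast
  next
    case False
    have "ce_strings {}" by (simp add: ce_strings_def ce_set_def)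
    from extend[OF that this] False show ?thesis unfolding Q_def by blast
  qed
  then have "\<exists>s. \<forall>n. \<Phi> (s n) \<and> Q n (s n) (s (Suc n))"
    using assms(1) dependent_nat_choice[of "\<lambda>_. \<Phi>" Q] by blast
  then obtain s where \<Phi>: "\<And>n. \<Phi> (s n)" and Q: "\<And>n. Q n (s n) (s (Suc n))" by blast
  have mono: "prefix (s m) (s n)" if "m \<le> n" for m n
    using that
  proof (induction n rule: dec_induct)
    case (step n)
    then show ?case using Q[of n] unfolding Q_def by (meson prefix_order.trans)
  qed simp
  have long: "n \<le> length (s n)" for n
  proof (induction n)
    case (Suc n)
    then show ?case using Q[of n] unfolding Q_def by linarith
  qed simp
  define G where "G = {i. \<exists>n. i < length (s n) \<and> s n ! i}"
  have agree: "s m ! i \<longleftrightarrow> s n ! i" if "i < length (s m)" "i < length (s n)" for m n i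
    using mono[of m n] mono[of n m] that
    by (cases "m \<le> n") (auto simp: prefix_def nth_append)
  have init: "initial_segment (s n) G" for n
    unfolding initial_segment_def G_def using agree by blast
  have init_prefix: "initial_segment \<mu> G" if \<mu>: "prefix \<mu> (s n)" for \<mu> n
    unfolding initial_segment_def
  proof (intro allI impI)
    fix i assume "i < length \<mu>"
    with \<mu> have "i < length (s n)" "s n ! i = \<mu> ! i"
      by (auto simp: prefix_def nth_append)
    then show "\<mu> ! i \<longleftrightarrow> i \<in> G" using init[of n] unfolding initial_segment_def by auto
  qed
  have "one_generic G"
    unfolding one_generic_def
  proof (intro allI impI)
    fix W assume W: "ce_strings W"
    then obtain n where n: "W = V n" using V by blast
    then show "\<exists>\<sigma>. initial_segment \<sigma> G \<and> (\<sigma> \<in> W \<or> \<not> (\<exists>\<tau>. prefix \<sigma> \<tau> \<and> \<tau> \<in> W))"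
      using Q[of n] W init_prefix unfolding Q_def by blast
  qed
  then show thesis using that init long \<Phi> by blast
qed

section \<open>Initial segments of subsequences\<close>

lemma enumerate_card_less:
  fixes I :: "nat set"
  assumes "infinite I" "m \<in> I"
  shows "enumerate I (card {i. i < m \<and> i \<in> I}) = m"
proof -
  obtain j where j: "enumerate I j = m" using enumerate_Ex[of I m] assms by blast
  have "{i. i < m \<and> i \<in> I} = enumerate I ` {..<j}"
  proof
    show "{i. i < m \<and> i \<in> I} \<subseteq> enumerate I ` {..<j}"
    proof
      fix i assume i: "i \<in> {i. i < m \<and> i \<in> I}"
      then obtain j' where j': "enumerate I j' = i" using enumerate_Ex[of I i] assms by blast
      with i j have "j' < j" using enumerate_mono_iff[OF assms(1)] by auto
      with j' show "i \<in> enumerate I ` {..<j}" by blast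
    qed
    show "enumerate I ` {..<j} \<subseteq> {i. i < m \<and> i \<in> I}"
      using j enumerate_mono_iff[OF assms(1)] enumerate_in_set[OF assms(1)] by auto
  qed
  moreover have "inj_on (enumerate I) {..<j}"
    using bij_enumerate[OF assms(1)] by (auto simp: bij_betw_def inj_on_def)
  ultimately show ?thesis using j by (simp add: card_image)
qed

lemma nths_snoc: "nths (xs @ [x]) A = nths xs A @ (if length xs \<in> A then [x] else [])"
  by (simp add: nths_append)

text \<open>
  \<open>nths \<sigma> I\<close> selects the bits of \<open>\<sigma>\<close> at positions in \<open>I\<close>: this is what \<open>\<sigma>\<close> determines of the
  subsequence.
\<close>

lemma initial_segment_nths:
  assumes "infinite I" "initial_segment \<sigma> G"
  shows "initial_segment (nths \<sigma> I) (subsequence I G)"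
  using assms(2)
proof (induction \<sigma> rule: rev_induct)
  case Nil
  then show ?case by (simp add: initial_segment_def)
next
  case (snoc b \<sigma>)
  have bit: "(\<sigma> @ [b]) ! i \<longleftrightarrow> i \<in> G" if "i < Suc (length \<sigma>)" for i
    using snoc.prems that by (simp add: initial_segment_def)
  have G: "\<sigma> ! i \<longleftrightarrow> i \<in> G" if "i < length \<sigma>" for i
    using bit[of i] that by (simp add: nth_append)
  have b: "b \<longleftrightarrow> length \<sigma> \<in> G" using bit[of "length \<sigma>"] by simp
  have IH: "initial_segment (nths \<sigma> I) (subsequence I G)"
    by (rule snoc.IH) (simp add: initial_segment_def G)
  show ?case
  proof (cases "length \<sigma> \<in> I")
    case True
    then have "enumerate I (length (nths \<sigma> I)) = length \<sigma>"
      using enumerate_card_less[OF assms(1)] by (simp add: length_nths)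
    then show ?thesis using IH b True
      by (auto simp: initial_segment_def nths_snoc nth_append subsequence_def less_Suc_eq)
  qed (use IH in \<open>simp add: nths_snoc\<close>)
qed

lemma initial_segment_prefix:
  assumes "initial_segment \<sigma> G" "initial_segment \<tau> G" "length \<sigma> \<le> length \<tau>"
  shows "prefix \<sigma> \<tau>"
proof -
  have "\<sigma> = take (length \<sigma>) \<tau>"
    using assms by (intro nth_equalityI) (auto simp: initial_segment_def)
  then show ?thesis by (metis take_is_prefix)
qed

section \<open>Sets with gaps that no computable function bounds\<close>

text \<open>
  The c.e. set of the strings \<open>1\<^sup>c 0\<close> is never met and never excluded along \<open>\<omega>\<close>.
\<close>

lemma UNIV_not_one_generic: "\<not> one_generic UNIV"
proof
  assume gen: "one_generic UNIV"
  define W where "W = range (\<lambda>c. replicate c True @ [False])"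
  have "string_code ` W = range (\<lambda>c. 2 * (2 ^ c - 1) + 2 ^ c * 1)"
    by (simp add: W_def image_image string_code_append string_code_replicate)
  moreover have "computable (\<lambda>c. 2 * (2 ^ c - 1) + 2 ^ c * 1)" by (intro computable_intros)
  ultimately have "ce_strings W" unfolding ce_strings_def ce_set_def by blast
  with gen obtain \<sigma> where \<sigma>: "initial_segment \<sigma> UNIV"
    "\<sigma> \<in> W \<or> \<not> (\<exists>\<tau>. prefix \<sigma> \<tau> \<and> \<tau> \<in> W)" unfolding one_generic_def by blast
  have "\<sigma> = replicate (length \<sigma>) True"
    using \<sigma>(1) by (intro nth_equalityI) (auto simp: initial_segment_def)
  then have "\<sigma> @ [False] \<in> W" unfolding W_def by (metis rangeI)
  moreover have "prefix \<sigma> (\<sigma> @ [False])" by simp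
  moreover have "\<sigma> \<notin> W"
  proof
    assume "\<sigma> \<in> W"
    then have "False \<in> set \<sigma>" by (auto simp: W_def)
    with \<open>\<sigma> = replicate _ _\<close> show False by (metis in_set_replicate)
  qed
  ultimately show False using \<sigma>(2) by blast
qed

text \<open>
  If all \<open>\<sigma>1\<^sup>n\<close> have extensions in \<open>V\<close>, the least witness of this gives a computable bound on the
  positions that such an extension occupies.  By hypothesis \<open>I\<close> misses the interval from the end of
  \<open>\<sigma>1\<^sup>n\<close> to that bound for some \<open>n\<close>, so the bits of the extension there are irrelevant to \<open>I\<close>.
\<close>

lemma generic_superset:
  assumes hyp: "\<And>f. computable f \<Longrightarrow> \<exists>n. \<forall>x\<in>I. \<not> (n \<le> x \<and> x < f n)"
  obtains G where "one_generic G" "I \<subseteq> G"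
proof -
  define \<Phi> where "\<Phi> \<sigma> \<longleftrightarrow> (\<forall>i < length \<sigma>. i \<in> I \<longrightarrow> \<sigma> ! i)" for \<sigma>
  have "\<exists>\<rho> \<mu>. prefix \<sigma> \<mu> \<and> prefix \<mu> \<rho> \<and> \<Phi> \<rho> \<and> length \<sigma> < length \<rho> \<and>
        (\<mu> \<in> V \<or> \<not> (\<exists>\<tau>. prefix \<mu> \<tau> \<and> \<tau> \<in> V))" if \<sigma>: "\<Phi> \<sigma>" and V: "ce_strings V" for \<sigma> V
  proof (cases "\<exists>n. \<not> (\<exists>\<tau>. prefix (\<sigma> @ replicate n True) \<tau> \<and> \<tau> \<in> V)")
    case True
    then obtain n where n: "\<not> (\<exists>\<tau>. prefix (\<sigma> @ replicate n True) \<tau> \<and> \<tau> \<in> V)" by blast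
    have "\<Phi> (\<sigma> @ replicate (Suc n) True)"
      using \<sigma> by (auto simp: \<Phi>_def nth_append simp del: replicate_Suc)
    moreover have "prefix (\<sigma> @ replicate n True) (\<sigma> @ replicate (Suc n) True)"
      by (metis append_assoc prefixI replicate_append_same replicate_Suc)
    ultimately show ?thesis
      using n by (intro exI[of _ "\<sigma> @ replicate (Suc n) True"] exI[of _ "\<sigma> @ replicate n True"]) simp
  next
    case False
    have "ce_pred (\<lambda>x. x \<in> string_code ` V)"
      using V unfolding ce_strings_def by (rule ce_pred_of_ce_set)
    from ce_predD[OF this] obtain D where D: "decidable (\<lambda>z. D (pfst z) (psnd z))"
      "\<And>x. x \<in> string_code ` V \<longleftrightarrow> (\<exists>w. D w x)" by blast
    define hit where "hit n t \<longleftrightarrow>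
      D (psnd t) (sapp (sapp (string_code \<sigma>) (2 * (2 ^ n - 1))) (pfst t))" for n t
    have hit: "hit n t \<longleftrightarrow> D (psnd t) (string_code (\<sigma> @ replicate n True @ z))"
      if "pfst t = string_code z" for n t z
      using that string_code_replicate[of n True]
      by (simp add: hit_def flip: append_assoc sapp_string_code)
    have ex: "\<exists>t. hit n t" for n
    proof -
      obtain z where "\<sigma> @ replicate n True @ z \<in> V" using False by (auto simp: prefix_def)
      then obtain w where "D w (string_code (\<sigma> @ replicate n True @ z))" using D(2) by blast
      then show ?thesis using hit[of "pair (string_code z) w" z n] by auto
    qed
    have "decidable (\<lambda>z. (\<lambda>z. D (pfst z) (psnd z)) (pair (psnd (pfst z))
        (sapp (sapp (string_code \<sigma>) (2 * (2 ^ (psnd z) - 1))) (pfst (pfst z)))))"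
      by (intro decidable_compose[OF D(1)] computable_intros computable_sapp)
    then have "decidable (\<lambda>z. hit (psnd z) (pfst z))" by (simp add: hit_def)
    then have least: "computable (\<lambda>n. LEAST t. hit n t)" using ex by (rule computable_Least)
    \<comment> \<open>The string \<open>\<sigma>1\<^sup>n\<close> with \<open>n = m - \<bar>\<sigma>\<bar>\<close> has length at least \<open>m\<close>, also when the subtraction is
      truncated; the summand \<open>\<bar>\<sigma>\<bar>\<close> accounts for the latter case.\<close>
    define f where "f m = m + length \<sigma> + (LEAST t. hit (m - length \<sigma>) t) + 1" for m
    have "computable f"
      unfolding f_def by (intro computable_intros computable_compose[OF least])
    from hyp[OF this] obtain m where m: "\<And>x. x \<in> I \<Longrightarrow> m \<le> x \<Longrightarrow> \<not> x < f m" by blast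
    define n where "n = m - length \<sigma>"
    define t where "t = (LEAST t. hit n t)"
    obtain z where z: "pfst t = string_code z"
      using bij_is_surj[OF bij_string_code] by (metis surjD)
    have "hit n t" unfolding t_def using ex by (rule LeastI_ex)
    then have "string_code (\<sigma> @ replicate n True @ z) \<in> string_code ` V"
      using hit[OF z] D(2) by blast
    then have inV: "\<sigma> @ replicate n True @ z \<in> V"
      using inj_image_mem_iff[OF bij_is_inj[OF bij_string_code]] by blast
    have "length z \<le> t"
      using z length_le_string_code[of z] pfst_le[of t] by simp
    then have "length \<sigma> + n + length z < f m" by (auto simp: f_def t_def n_def)
    moreover have "m \<le> length \<sigma> + n" by (simp add: n_def)
    ultimately have far: "i < length \<sigma> + n \<or> length \<sigma> + n + length z \<le> i" if "i \<in> I" for i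
      using m[of i] that by linarith
    have "\<Phi> ((\<sigma> @ replicate n True @ z) @ [True])"
      unfolding \<Phi>_def
    proof (intro allI impI)
      fix i assume "i < length ((\<sigma> @ replicate n True @ z) @ [True])" "i \<in> I"
      then consider "i < length \<sigma> + n" | "i = length (\<sigma> @ replicate n True @ z)"
        using far[of i] by fastforce
      then show "((\<sigma> @ replicate n True @ z) @ [True]) ! i"
        using \<sigma> \<open>i \<in> I\<close> by cases (auto simp: \<Phi>_def nth_append)
    qed
    with inV show ?thesis
      by (intro exI[of _ "(\<sigma> @ replicate n True @ z) @ [True]"] exI[of _ "\<sigma> @ replicate n True @ z"])
        simp
  qed
  moreover have "\<Phi> []" by (simp add: \<Phi>_def)
  ultimately obtain G where G: "one_generic G"
    "\<And>n. \<exists>\<sigma>. initial_segment \<sigma> G \<and> n \<le> length \<sigma> \<and> \<Phi> \<sigma>"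
    using generic_from_extensions[of \<Phi>] by blast
  have "I \<subseteq> G"
  proof
    fix i assume i: "i \<in> I"
    obtain \<sigma> where "initial_segment \<sigma> G" "Suc i \<le> length \<sigma>" "\<Phi> \<sigma>" using G(2) by blast
    then show "i \<in> G" using i by (auto simp: \<Phi>_def initial_segment_def)
  qed
  with G(1) show thesis by (rule that)
qed

lemma generic_subsequence_if_sparse:
  assumes "infinite I" "\<And>f. computable f \<Longrightarrow> \<exists>n. \<forall>x\<in>I. \<not> (n \<le> x \<and> x < f n)"
  shows "\<exists>G. one_generic G \<and> \<not> one_generic (subsequence I G)"
proof -
  obtain G where "one_generic G" "I \<subseteq> G" using generic_superset[OF assms(2)] by blast
  moreover have "subsequence I G = UNIV"
    using \<open>I \<subseteq> G\<close> enumerate_in_set[OF assms(1)] by (auto simp: subsequence_def)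
  ultimately show ?thesis using UNIV_not_one_generic by auto
qed

section \<open>Messages and their reader\<close>

lemma strip_run:
  assumes "b' \<noteq> b" "replicate c b @ b' # x = replicate c' b @ b' # y"
  shows "c = c' \<and> x = y"
  using assms(2)
proof (induction c arbitrary: c')
  case 0
  then show ?case using assms(1) by (cases c') auto
next
  case (Suc c)
  then show ?case using assms(1) by (cases c') auto
qed

lemma strip_two_runs:
  assumes "replicate c True @ replicate r False @ True # x
      = replicate c' True @ replicate r' False @ True # y" "0 < r" "0 < r'"
  shows "c = c' \<and> r = r' \<and> x = y"
proof -
  obtain r0 r0' where r: "r = Suc r0" "r' = Suc r0'" using assms(2,3) gr0_implies_Suc by metis
  from assms(1) have "c = c' \<and> replicate r0 False @ True # x = replicate r0' False @ True # y"
    unfolding r using strip_run[of False True c "replicate r0 False @ True # x" c' "replicate r0' False @ True # y"] by simp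
  then show ?thesis using strip_run[of True False r0 x r0' y] r by simp
qed

text \<open>
  The number of ones at the start of a message with index \<open>k\<close> lies in the cell
  \<open>(cell_end f k, cell_end f (Suc k)]\<close>, for every string \<open>\<sigma>\<close> with \<open>\<bar>\<sigma>\<bar> \<le> k\<close> and every \<open>I\<close> whose gaps
  are bounded by \<open>f\<close>: the ones fill the positions from \<open>\<bar>\<sigma>\<bar>\<close> to \<open>cell_end f (Suc k)\<close>, and
  \<open>cell_end f k + 1\<close> iterations of \<open>f\<close> starting at \<open>k\<close> pass at least as many elements of \<open>I\<close>.  Distinct
  indices have disjoint cells, so the reader recovers \<open>k\<close> without knowing \<open>I\<close>.
\<close>

primrec cell_end :: "(nat \<Rightarrow> nat) \<Rightarrow> nat \<Rightarrow> nat" where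
  "cell_end f 0 = 0"
| "cell_end f (Suc k) = (f ^^ Suc (cell_end f k)) k"

text \<open>
  \<open>f\<close> bounds the gaps of \<open>I\<close>, which itself is hidden from the reader; \<open>D\<close> is the matrix of a universal
  c.e. set.
\<close>

locale message_system =
  fixes f :: "nat \<Rightarrow> nat" and D :: "nat \<Rightarrow> nat \<Rightarrow> nat \<Rightarrow> bool"
  assumes computable_f: "computable f"
    and decidable_D: "decidable (\<lambda>z. D (pfst z) (pfst (psnd z)) (psnd (psnd z)))"
    and less_f: "n < f n"
begin

abbreviation bound :: "nat \<Rightarrow> nat" where "bound \<equiv> cell_end f"

lemma funpow_f_ge: "m + n \<le> (f ^^ m) n"
proof (induction m)
  case (Suc m)
  then show ?case using less_f[of "(f ^^ m) n"] by simp
qed simp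

lemma bound_less: "bound k < bound (Suc k)" and index_less_bound: "k < bound (Suc k)"
  using funpow_f_ge[of "Suc (bound k)" k] by simp_all

lemma bound_mono: "k \<le> l \<Longrightarrow> bound k \<le> bound l"
  by (rule lift_Suc_mono_le[of bound]) (rule less_imp_le[OF bound_less])

lemma cell_unique:
  assumes "bound k < c" "c \<le> bound (Suc k)" "bound l < c" "c \<le> bound (Suc l)"
  shows "k = l"
proof (rule ccontr)
  assume "k \<noteq> l"
  then consider "Suc k \<le> l" | "Suc l \<le> k" by linarith
  then show False using bound_mono[of "Suc k" l] bound_mono[of "Suc l" k] assms by cases linarith+
qed

text \<open>
  The zeros up to \<open>n\<close> are followed by ones up to \<open>f n\<close>, which guarantees that a \<open>1\<close> is seen through
  \<open>I\<close> and so that the number of zeros seen is settled.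
\<close>

definition msg :: "nat \<Rightarrow> nat \<Rightarrow> bool list \<Rightarrow> bool list" where
  "msg k n \<sigma> = \<sigma> @ replicate (bound (Suc k) - length \<sigma>) True @
     replicate (n - bound (Suc k)) False @ replicate (f n - n) True"

definition msg_code :: "nat \<Rightarrow> nat \<Rightarrow> nat \<Rightarrow> nat" where
  "msg_code k n s = sapp s (sapp (2 * (2 ^ (bound (Suc k) - slen s) - 1))
     (sapp (2 ^ (n - bound (Suc k)) - 1) (2 * (2 ^ (f n - n) - 1))))"

lemma msg_code [simp]: "msg_code k n (string_code \<sigma>) = string_code (msg k n \<sigma>)"
proof -
  have rep: "string_code (replicate m True) = 2 * (2 ^ m - 1)"
    "string_code (replicate m False) = 2 ^ m - 1" for m
    by (simp_all add: string_code_replicate)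
  have "string_code (msg k n \<sigma>) = sapp (string_code \<sigma>)
      (sapp (string_code (replicate (bound (Suc k) - length \<sigma>) True))
        (sapp (string_code (replicate (n - bound (Suc k)) False))
          (string_code (replicate (f n - n) True))))"
    by (simp only: msg_def sapp_string_code)
  then show ?thesis by (simp only: msg_code_def rep slen_string_code)
qed

definition msg_index :: "nat \<Rightarrow> nat \<Rightarrow> nat \<Rightarrow> nat" where "msg_index s e i = pair s (pair e i)"

text \<open>
  \<open>v\<close> consists of a string \<open>z\<close> and a witness that the message for \<open>i\<close> and \<open>n\<close>, followed by \<open>z\<close>, lies
  in the \<open>e\<close>-th c.e. set.  The lower bound on \<open>n\<close> guarantees that at least one zero is seen through
  \<open>I\<close>.
\<close>

definition found :: "nat \<Rightarrow> nat \<Rightarrow> nat \<Rightarrow> nat \<Rightarrow> nat \<Rightarrow> bool" where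
  "found s e i n v \<longleftrightarrow> f (bound (Suc (msg_index s e i))) \<le> n \<and>
     D e (sapp (msg_code (msg_index s e i) n s) (pfst v)) (psnd v)"

text \<open>
  \<open>n = pfst t\<close> must work for both values of the bit, since the reader cannot tell which of them is
  the right one for \<open>n\<close>.
\<close>

definition stage :: "nat \<Rightarrow> nat \<Rightarrow> nat \<Rightarrow> bool" where
  "stage s e t \<longleftrightarrow>
     found s e 0 (pfst t) (pfst (psnd t)) \<and> found s e 1 (pfst t) (psnd (psnd t))"

text \<open>
  Minimality makes the number of bits that the reader ignores unambiguous.
\<close>

definition first_stage :: "nat \<Rightarrow> nat \<Rightarrow> bool" where
  "first_stage k t \<longleftrightarrow> stage (pfst k) (pfst (psnd k)) t \<and>
     (\<forall>t'<t. \<not> stage (pfst k) (pfst (psnd k)) t')"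

text \<open>
  The parity of \<open>c + r\<close> rather than that of \<open>r\<close> is compared with the bit, because \<open>c + r\<close> does not
  depend on where the first block ends, which varies with the bit.
\<close>

definition special :: "nat \<Rightarrow> nat \<Rightarrow> nat \<Rightarrow> bool" where
  "special k c r \<longleftrightarrow> (c + r) mod 2 = psnd (psnd k)"

text \<open>
  The message that follows a parsed string \<open>\<tau>\<close>, as seen through \<open>I\<close>.  In the special case the message
  for \<open>n = pfst t\<close> ends at position \<open>f n\<close> and the string appended to it has at most \<open>t\<close> bits, so
  \<open>f n + t\<close> bits are enough to cover both.
\<close>

definition step :: "bool list \<Rightarrow> bool list \<Rightarrow> bool" where
  "step \<tau> \<tau>' \<longleftrightarrow> (\<exists>k c r. bound k < c \<and> c \<le> bound (Suc k) \<and> 0 < r \<and>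
     ((\<not> special k c r \<and> (\<exists>q>0. \<tau>' =
          \<tau> @ replicate c True @ replicate r False @ replicate q True @ [False])) \<or>
      (special k c r \<and> (\<exists>t u. first_stage k t \<and> length u = f (pfst t) + t \<and> \<tau>' =
          \<tau> @ replicate c True @ replicate r False @ [True] @ u))))"

abbreviation parsed :: "bool list \<Rightarrow> bool" where "parsed \<equiv> step\<^sup>*\<^sup>* []"

lemma step_cases:
  assumes "step \<tau> \<tau>'"
  shows "\<exists>k c r x. bound k < c \<and> c \<le> bound (Suc k) \<and> 0 < r \<and>
    \<tau>' = \<tau> @ replicate c True @ replicate r False @ True # x \<and>
    (if special k c r then \<exists>t. first_stage k t \<and> length x = f (pfst t) + t
     else \<exists>q. x = replicate q True @ [False])"
proof -
  from assms obtain k c r where kcr: "bound k < c" "c \<le> bound (Suc k)" "0 < r"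
    and alt: "(\<not> special k c r \<and> (\<exists>q>0. \<tau>' =
          \<tau> @ replicate c True @ replicate r False @ replicate q True @ [False])) \<or>
      (special k c r \<and> (\<exists>t u. first_stage k t \<and> length u = f (pfst t) + t \<and> \<tau>' =
          \<tau> @ replicate c True @ replicate r False @ [True] @ u))"
    unfolding step_def by blast
  from alt have "\<exists>x. \<tau>' = \<tau> @ replicate c True @ replicate r False @ True # x \<and>
    (if special k c r then \<exists>t. first_stage k t \<and> length x = f (pfst t) + t
     else \<exists>q. x = replicate q True @ [False])"
  proof (elim disjE conjE exE)
    fix q assume *: "\<not> special k c r" "(0::nat) < q"
      "\<tau>' = \<tau> @ replicate c True @ replicate r False @ replicate q True @ [False]"
    obtain q' where "q = Suc q'" using *(2) gr0_implies_Suc by blast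
    with *(1,3) show ?thesis by (intro exI[of _ "replicate q' True @ [False]"]) auto
  next
    fix t u assume "special k c r" "first_stage k t" "length u = f (pfst t) + t"
      "\<tau>' = \<tau> @ replicate c True @ replicate r False @ [True] @ u"
    then show ?thesis by (intro exI[of _ u]) auto
  qed
  with kcr show ?thesis by blast
qed

lemma first_stage_unique: "first_stage k t \<Longrightarrow> first_stage k t' \<Longrightarrow> t = t'"
  unfolding first_stage_def by (meson linorder_neqE_nat)

text \<open>
  The numbers \<open>c\<close> and \<open>r\<close> are run lengths, hence determined by \<open>Z\<close>; \<open>c\<close> determines the index \<open>k\<close>, and
  the end of the message is then fixed either by the next run or by the first stage.
\<close>

lemma step_deterministic:
  assumes "step \<tau> a" "step \<tau> b" "prefix a Z" "prefix b Z"
  shows "a = b"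
proof -
  obtain k c r x where a: "bound k < c" "c \<le> bound (Suc k)" "0 < r"
    "a = \<tau> @ replicate c True @ replicate r False @ True # x"
    "if special k c r then \<exists>t. first_stage k t \<and> length x = f (pfst t) + t
     else \<exists>q. x = replicate q True @ [False]"
    using step_cases[OF assms(1)] by (elim exE conjE) (rule that)
  obtain k' c' r' x' where b: "bound k' < c'" "c' \<le> bound (Suc k')" "0 < r'"
    "b = \<tau> @ replicate c' True @ replicate r' False @ True # x'"
    "if special k' c' r' then \<exists>t. first_stage k' t \<and> length x' = f (pfst t) + t
     else \<exists>q. x' = replicate q True @ [False]"
    using step_cases[OF assms(2)] by (elim exE conjE) (rule that)
  obtain y where y: "Z = a @ y" using assms(3) by (auto simp: prefix_def)
  obtain y' where y': "Z = b @ y'" using assms(4) by (auto simp: prefix_def)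
  have "a @ y = b @ y'" using y y' by simp
  then have "replicate c True @ replicate r False @ True # (x @ y)
      = replicate c' True @ replicate r' False @ True # (x' @ y')"
    unfolding a(4) b(4) by simp
  then have eq: "c = c'" "r = r'" "x @ y = x' @ y'"
    using strip_two_runs[of c r "x @ y" c' r' "x' @ y'"] a(3) b(3) by auto
  have k: "k = k'" using cell_unique[OF a(1,2)] b(1,2) eq(1) by simp
  have "x = x'"
  proof (cases "special k c r")
    case True
    obtain t where t: "first_stage k t" "length x = f (pfst t) + t"
      using a(5)[unfolded if_P[OF True]] by blast
    obtain t' where t': "first_stage k t'" "length x' = f (pfst t') + t'"
      using b(5)[folded k eq(1,2), unfolded if_P[OF True]] by blast
    have "t = t'" using first_stage_unique[OF t(1) t'(1)] .
    then have "length x = length x'" using t(2) t'(2) by simp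
    with eq(3) show ?thesis by simp
  next
    case False
    obtain q where q: "x = replicate q True @ [False]"
      using a(5)[unfolded if_not_P[OF False]] by blast
    obtain q' where q': "x' = replicate q' True @ [False]"
      using b(5)[folded k eq(1,2), unfolded if_not_P[OF False]] by blast
    from eq(3) have "q = q'" unfolding q q' using strip_run[of False True q y q' y'] by simp
    then show ?thesis unfolding q q' by simp
  qed
  then show ?thesis using a(4) b(4) eq by simp
qed

lemma step_prefix:
  assumes "step \<tau> \<tau>'" shows "prefix (\<tau> @ [True]) \<tau>'"
proof -
  obtain k c r x where c: "bound k < c"
    and \<tau>': "\<tau>' = \<tau> @ replicate c True @ replicate r False @ True # x"
    using step_cases[OF assms] by (elim exE conjE) (rule that)
  obtain c0 where "c = Suc c0" using c by (cases c) auto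
  with \<tau>' show ?thesis by simp
qed

lemma step_prefix': "step \<tau> \<tau>' \<Longrightarrow> prefix \<tau> \<tau>'"
  by (rule append_prefixD[OF step_prefix])

lemma steps_prefix: "step\<^sup>*\<^sup>* \<tau> \<tau>' \<Longrightarrow> prefix \<tau> \<tau>'"
proof (induction rule: rtranclp_induct)
  case (step a b)
  then show ?case using step_prefix'[of a b] prefix_order.trans by blast
qed simp

text \<open>
  By determinism, the parsed initial segments of a string form a single chain of steps.
\<close>

lemma parsed_comparable:
  assumes "parsed \<tau>" "prefix \<tau> Z"
  shows "parsed \<tau>' \<Longrightarrow> prefix \<tau>' Z \<Longrightarrow> step\<^sup>*\<^sup>* \<tau> \<tau>' \<or> step\<^sup>*\<^sup>* \<tau>' \<tau>"
proof (induction rule: rtranclp_induct)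
  case base
  then show ?case using assms(1) by blast
next
  case (step a b)
  have "prefix a Z"
    using step_prefix'[OF step.hyps(2)] step.prems by (rule prefix_order.trans)
  then consider "step\<^sup>*\<^sup>* \<tau> a" | "step\<^sup>*\<^sup>* a \<tau>" using step.IH by blast
  then show ?case
  proof cases
    case 1
    then show ?thesis using step.hyps(2) by (meson rtranclp.rtrancl_into_rtrancl)
  next
    case 2
    then show ?thesis
    proof (cases rule: converse_rtranclpE)
      case base
      then show ?thesis using step.hyps(2) by blast
    next
      case (step b')
      then have "prefix b' Z" using steps_prefix assms(2) prefix_order.trans by blast
      then have "b' = b" using step_deterministic step(1) \<open>step a b\<close> \<open>prefix b Z\<close> by blast
      then show ?thesis using step(2) by blast
    qed
  qed
qed

lemma parsed_followed_by_True:
  assumes "parsed \<tau>" "parsed \<tau>'" "prefix \<tau> Z" "prefix \<tau>' Z" "length \<tau> < length \<tau>'"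
  shows "\<not> prefix (\<tau> @ [False]) Z"
proof -
  have "\<not> step\<^sup>*\<^sup>* \<tau>' \<tau>" using steps_prefix[of \<tau>' \<tau>] prefix_length_le assms(5) by fastforce
  then have "step\<^sup>*\<^sup>* \<tau> \<tau>'" using parsed_comparable[OF assms(1,3,2,4)] by blast
  then show ?thesis
  proof (cases rule: converse_rtranclpE)
    case base
    then show ?thesis using assms(5) by simp
  next
    case (step \<rho>)
    have "prefix (\<tau> @ [True]) Z"
      using step_prefix[OF step(1)] steps_prefix[OF step(2)] assms(4)
      by (blast intro: prefix_order.trans)
    then show ?thesis by (auto simp: prefix_def)
  qed
qed

section \<open>Enumerability of the violations\<close>

lemma computable_bound: "computable h \<Longrightarrow> computable (\<lambda>x. bound (h x))"
proof -
  assume h: "computable h"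
  have 1: "(f ^^ m) k = rec_nat k (\<lambda>_ r. f r) m" for m k by (induction m) auto
  have 2: "bound m = rec_nat 0 (\<lambda>k r. rec_nat k (\<lambda>_ r. f r) (Suc r)) m" for m
    by (induction m) (simp_all add: 1)
  show ?thesis unfolding 2
    by (intro computable_rec computable_intros computable_compose[OF computable_f] h)
qed

lemma decidable_found:
  assumes "computable s" "computable e" "computable i" "computable n" "computable v"
  shows "decidable (\<lambda>x. found (s x) (e x) (i x) (n x) (v x))"
proof -
  have D: "decidable (\<lambda>x. D (a x) (b x) (c x))" if "computable a" "computable b" "computable c" for a b c
    using decidable_compose[OF decidable_D, of "\<lambda>x. pair (a x) (pair (b x) (c x))"]
    by (simp add: computable_pair that)
  show ?thesis unfolding found_def msg_index_def msg_code_def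
    by (intro decidable_conj decidable_le D computable_sapp computable_slen computable_bound
        computable_intros computable_compose[OF computable_f] assms)
qed

lemma decidable_first_stage:
  assumes "computable k" "computable t"
  shows "decidable (\<lambda>x. first_stage (k x) (t x))"
  unfolding first_stage_def stage_def
  by (intro decidable_conj decidable_all_less decidable_not decidable_found computable_intros
      computable_compose[OF assms(1)] assms)

text \<open>
  A transcription of \<open>step\<close> to codes of strings: \<open>2 * (2 ^ c - 1)\<close> is the code of \<open>c\<close> ones, \<open>2 ^ r - 1\<close>
  that of \<open>r\<close> zeros, and \<open>1\<close> and \<open>2\<close> are the codes of the single bits \<open>0\<close> and \<open>1\<close>.
\<close>

definition step_code :: "nat \<Rightarrow> nat \<Rightarrow> bool" where
  "step_code x z \<longleftrightarrow> (\<exists>k c r. bound k < c \<and> c \<le> bound (Suc k) \<and> 0 < r \<and>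
     ((\<not> special k c r \<and> (\<exists>q. 0 < q \<and> z =
          sapp x (sapp (2 * (2 ^ c - 1)) (sapp (2 ^ r - 1) (sapp (2 * (2 ^ q - 1)) 1))))) \<or>
      (special k c r \<and> (\<exists>t u. first_stage k t \<and> slen u = f (pfst t) + t \<and> z =
          sapp x (sapp (2 * (2 ^ c - 1)) (sapp (2 ^ r - 1) (sapp 2 u)))))))"

lemma ex_string_code: "(\<exists>x. P x) \<longleftrightarrow> (\<exists>u. P (string_code u))"
  using bij_is_surj[OF bij_string_code] by (metis surjD)

lemma step_code: "step_code (string_code \<tau>) (string_code \<tau>') \<longleftrightarrow> step \<tau> \<tau>'"
proof -
  have rep: "string_code (replicate n True) = 2 * (2 ^ n - 1)"
    "string_code (replicate n False) = 2 ^ n - 1"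
    "string_code [False] = 1" "string_code [True] = 2" for n
    by (simp_all add: string_code_replicate)
  have inj: "string_code a = string_code b \<longleftrightarrow> a = b" for a b
    using bij_is_inj[OF bij_string_code] by (simp add: inj_eq)
  have "sapp (string_code \<tau>) (sapp (string_code (replicate c True))
      (sapp (string_code (replicate r False)) (sapp (string_code (replicate q True)) (string_code [False]))))
    = string_code (\<tau> @ replicate c True @ replicate r False @ replicate q True @ [False])" for c r q
    by (simp only: sapp_string_code)
  note e1 = this[unfolded rep]
  have "sapp (string_code \<tau>) (sapp (string_code (replicate c True))
      (sapp (string_code (replicate r False)) (sapp (string_code [True]) (string_code u))))
    = string_code (\<tau> @ replicate c True @ replicate r False @ [True] @ u)" for c r u
    by (simp only: sapp_string_code)
  note e2 = this[unfolded rep]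
  have e3: "(\<exists>t u. first_stage k t \<and> slen u = f (pfst t) + t \<and> string_code \<tau>' =
        sapp (string_code \<tau>) (sapp (2 * (2 ^ c - 1)) (sapp (2 ^ r - 1) (sapp 2 u))))
    \<longleftrightarrow> (\<exists>t u. first_stage k t \<and> length u = f (pfst t) + t \<and> \<tau>' =
        \<tau> @ replicate c True @ replicate r False @ [True] @ u)" for k c r
    by (rule arg_cong[where f = Ex], rule ext, subst ex_string_code)
      (simp only: e2 inj slen_string_code)
  show ?thesis
    unfolding step_code_def step_def e3 unfolding e1 inj ..
qed

lemma ce_step_code: "ce_pred (\<lambda>t. step_code (pfst t) (psnd (psnd t)))"
  unfolding step_code_def special_def
  by (intro ce_ex ce_conj ce_disj ce_decidable decidable_not decidable_less decidable_le decidable_eq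
      decidable_first_stage computable_bound computable_slen computable_sapp computable_intros
      computable_compose[OF computable_f])

lemma parsed_iff_gen: "parsed \<tau> \<longleftrightarrow> gen (\<lambda>x y z. step_code x z) (string_code \<tau>)"
proof
  assume "parsed \<tau>"
  then show "gen (\<lambda>x y z. step_code x z) (string_code \<tau>)"
  proof (induction rule: rtranclp_induct)
    case base
    show ?case using gen_zero by simp
  next
    case (step a b)
    then show ?case using gen_step[OF step.IH gen_zero] by (simp add: step_code)
  qed
next
  have "parsed \<tau>" if "gen (\<lambda>x y z. step_code x z) s" "s = string_code \<tau>" for s \<tau>
    using that
  proof (induction arbitrary: \<tau>)
    case gen_zero
    then show ?case by (cases \<tau>) (auto split: if_splits)
  next
    case (gen_step x y z)
    obtain \<rho> where \<rho>: "x = string_code \<rho>" using surjD[OF bij_is_surj[OF bij_string_code], of x] by blast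
    have "parsed \<rho>" using gen_step.IH(1)[OF \<rho>] .
    moreover have "step \<rho> \<tau>" using gen_step.hyps(3) unfolding \<rho> gen_step.prems step_code .
    ultimately show ?case by (rule rtranclp.rtrancl_into_rtrancl)
  qed
  then show "gen (\<lambda>x y z. step_code x z) (string_code \<tau>) \<Longrightarrow> parsed \<tau>" by blast
qed

definition violations :: "bool list set" where
  "violations = (\<lambda>\<tau>. \<tau> @ [False]) ` {\<tau>. parsed \<tau>}"

lemma ce_violations: "ce_strings violations"
proof -
  define P where "P y \<longleftrightarrow> (\<exists>x. gen (\<lambda>x y z. step_code x z) x \<and> y = sapp x 1)" for y
  have "ce_pred (gen (\<lambda>x y z. step_code x z))" by (rule ce_gen) (rule ce_step_code)
  then have "ce_pred (\<lambda>z. gen (\<lambda>x y z. step_code x z) (pfst z))"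
    by (rule ce_compose) (intro computable_intros)
  moreover have "ce_pred (\<lambda>z. psnd z = sapp (pfst z) 1)"
    by (intro ce_eq computable_sapp computable_intros)
  ultimately have "ce_pred P"
    unfolding P_def by (intro ce_ex ce_conj)
  then have "ce_set {y. P y}" by (rule ce_set_of_ce_pred)
  moreover have "{y. P y} = string_code ` violations"
  proof -
    have sapp_1: "sapp (string_code \<tau>) 1 = string_code (\<tau> @ [False])" for \<tau>
      using sapp_string_code[of \<tau> "[False]"] by simp
    have "P y \<longleftrightarrow> (\<exists>\<tau>. parsed \<tau> \<and> y = string_code (\<tau> @ [False]))" for y
      unfolding P_def by (subst ex_string_code) (simp only: parsed_iff_gen sapp_1)
    then show ?thesis unfolding violations_def image_image by (auto simp only: image_iff)
  qed
  ultimately show ?thesis unfolding ce_strings_def by simp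
qed

text \<open>
  Along \<open>X\<close> a violation can always still be reached, by appending a \<open>0\<close> to a parsed initial segment,
  but it never occurs: every parsed initial segment of \<open>X\<close> is followed by a further message, which
  starts with a \<open>1\<close>.
\<close>

lemma not_one_generic_if_parsed:
  assumes "\<And>n. \<exists>\<tau>. initial_segment \<tau> X \<and> n \<le> length \<tau> \<and> parsed \<tau>"
  shows "\<not> one_generic X"
proof
  assume "one_generic X"
  then obtain \<sigma> where \<sigma>: "initial_segment \<sigma> X"
    "\<sigma> \<in> violations \<or> \<not> (\<exists>\<tau>. prefix \<sigma> \<tau> \<and> \<tau> \<in> violations)"
    using ce_violations unfolding one_generic_def by blast
  obtain \<tau> where \<tau>: "initial_segment \<tau> X" "length \<sigma> \<le> length \<tau>" "parsed \<tau>" using assms by blast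
  then have "prefix \<sigma> \<tau>" using initial_segment_prefix \<sigma>(1) by blast
  then have "prefix \<sigma> (\<tau> @ [False])" by (rule prefix_order.trans) simp
  moreover have "\<tau> @ [False] \<in> violations" using \<tau>(3) by (simp add: violations_def)
  ultimately have "\<sigma> \<in> violations" using \<sigma>(2) by blast
  then obtain \<rho> where \<rho>: "\<sigma> = \<rho> @ [False]" "parsed \<rho>" by (auto simp: violations_def)
  have "prefix \<rho> \<tau>" using \<open>prefix \<sigma> \<tau>\<close> \<rho>(1) append_prefixD by blast
  moreover have "length \<rho> < length \<tau>" using \<tau>(2) \<rho>(1) by simp
  ultimately show False
    using parsed_followed_by_True[OF \<rho>(2) \<tau>(3), of \<tau>] \<open>prefix \<sigma> \<tau>\<close> \<rho>(1) by simp
qed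

end

section \<open>Extending a condition by a message\<close>

definition cnt :: "nat set \<Rightarrow> nat \<Rightarrow> nat \<Rightarrow> nat" where
  "cnt I a b = (\<Sum>i = a..<b. of_bool (i \<in> I))"

lemma cnt_Suc: "a \<le> b \<Longrightarrow> cnt I a (Suc b) = cnt I a b + of_bool (b \<in> I)"
  by (simp add: cnt_def)

lemma cnt_concat: "a \<le> b \<Longrightarrow> b \<le> c \<Longrightarrow> cnt I a b + cnt I b c = cnt I a c"
  unfolding cnt_def by (rule sum.atLeastLessThan_concat)

lemma cnt_le: "cnt I a b \<le> b - a"
  unfolding cnt_def using sum_bounded_above[of "{a..<b}" "\<lambda>i. of_bool (i \<in> I)" "1::nat"] by simp

lemma cnt_pos:
  assumes "i \<in> I" "a \<le> i" "i < b" shows "0 < cnt I a b"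
proof -
  have "cnt I a b = cnt I a i + cnt I i b" using cnt_concat[of a i b I] assms by simp
  also have "cnt I i b = cnt I i (Suc i) + cnt I (Suc i) b"
    using cnt_concat[of i "Suc i" b I] assms by simp
  also have "cnt I i (Suc i) = 1" using assms(1) by (simp add: cnt_def)
  finally show ?thesis by simp
qed

lemma nths_append_replicate:
  "nths (\<sigma> @ replicate m b) I =
     nths \<sigma> I @ replicate (cnt I (length \<sigma>) (length \<sigma> + m)) b"
proof (induction m)
  case 0
  then show ?case by (simp add: cnt_def)
next
  case (Suc m)
  have "\<sigma> @ replicate (Suc m) b = (\<sigma> @ replicate m b) @ [b]"
    by (simp add: replicate_append_same)
  then have "nths (\<sigma> @ replicate (Suc m) b) I =
      nths (\<sigma> @ replicate m b) I @ (if length \<sigma> + m \<in> I then [b] else [])"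
    by (simp only: nths_snoc length_append length_replicate)
  also have "\<dots> = nths \<sigma> I @ replicate (cnt I (length \<sigma>) (Suc (length \<sigma> + m))) b"
    unfolding Suc.IH by (simp add: cnt_Suc replicate_append_same flip: replicate_Suc)
  finally show ?case by simp
qed

lemma cnt_funpow:
  assumes "\<And>n. \<exists>x\<in>I. n \<le> x \<and> x < f n"
  shows "j \<le> cnt I a ((f ^^ j) a) \<and> a \<le> (f ^^ j) a"
proof (induction j)
  case (Suc j)
  obtain x where x: "x \<in> I" "(f ^^ j) a \<le> x" "x < f ((f ^^ j) a)" using assms by blast
  then have "0 < cnt I ((f ^^ j) a) (f ((f ^^ j) a))" by (rule cnt_pos)
  moreover have "cnt I a ((f ^^ j) a) + cnt I ((f ^^ j) a) (f ((f ^^ j) a)) = cnt I a (f ((f ^^ j) a))"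
    using Suc x by (intro cnt_concat) auto
  ultimately show ?case using Suc x by simp
qed simp

lemma nat_intermediate:
  fixes g :: "nat \<Rightarrow> nat"
  assumes "g 0 \<le> N" "N \<le> g m" "\<And>i. g (Suc i) \<le> Suc (g i)"
  shows "\<exists>i. g i = N"
proof -
  have "N \<le> g (LEAST i. N \<le> g i)" using assms(2) by (rule LeastI)
  moreover have "g (LEAST i. N \<le> g i) \<le> N"
  proof (cases "LEAST i. N \<le> g i")
    case 0
    then show ?thesis using assms(1) by simp
  next
    case (Suc i)
    then have "\<not> N \<le> g i" using not_less_Least[of i "\<lambda>i. N \<le> g i"] by simp
    then show ?thesis using assms(3)[of i] Suc by simp
  qed
  ultimately show ?thesis by (intro exI[of _ "LEAST i. N \<le> g i"]) simp
qed

text \<open>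
  One more bit of \<open>\<rho>\<close> shows at most one more bit through \<open>I\<close>, so every length is attained exactly.
\<close>

lemma padding:
  assumes "\<And>n. \<exists>x\<in>I. n \<le> x \<and> x < f n" "length (nths \<rho> I) \<le> N"
  shows "\<exists>m. length (nths (\<rho> @ replicate m b) I) = N"
proof -
  define g where "g m = length (nths (\<rho> @ replicate m b) I)" for m
  have g: "g m = length (nths \<rho> I) + cnt I (length \<rho>) (length \<rho> + m)" for m
    by (simp add: g_def nths_append_replicate)
  have "N \<le> g ((f ^^ N) (length \<rho>) - length \<rho>)"
    using cnt_funpow[OF assms(1), of N "length \<rho>"] by (simp add: g)
  moreover have "g (Suc i) \<le> Suc (g i)" for i by (simp add: g cnt_Suc)
  moreover have "g 0 \<le> N" using assms(2) by (simp add: g_def)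
  ultimately show ?thesis using nat_intermediate[of g N] unfolding g_def by blast
qed

context message_system
begin

text \<open>
  The lower bound on the number \<open>c\<close> of ones comes from iterating \<open>f\<close>, since each iteration passes an
  element of \<open>I\<close>; it puts \<open>c\<close> into the cell of \<open>k\<close>.
\<close>

lemma nths_msg:
  assumes gap: "\<And>n. \<exists>x\<in>I. n \<le> x \<and> x < f n"
    and "length \<sigma> \<le> k" "f (bound (Suc k)) \<le> n"
  obtains c r q where "nths (msg k n \<sigma>) I =
      nths \<sigma> I @ replicate c True @ replicate r False @ replicate q True"
    "bound k < c" "c \<le> bound (Suc k)" "0 < r" "0 < q" "c + r = cnt I (length \<sigma>) n"
    "bound (Suc k) \<le> n" "length (msg k n \<sigma>) = f n"
proof -
  let ?a = "bound (Suc k)"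
  let ?\<sigma>1 = "\<sigma> @ replicate (?a - length \<sigma>) True"
  let ?\<sigma>2 = "?\<sigma>1 @ replicate (n - ?a) False"
  have le: "length \<sigma> \<le> ?a" "?a \<le> n" "n \<le> f n"
    using assms(2,3) index_less_bound[of k] less_f[of ?a] less_f[of n] by linarith+
  have len: "length ?\<sigma>1 = ?a" "length ?\<sigma>2 = n"
    using le by simp_all
  have msg: "msg k n \<sigma> = ?\<sigma>2 @ replicate (f n - n) True" by (simp add: msg_def)
  have "nths ?\<sigma>1 I = nths \<sigma> I @ replicate (cnt I (length \<sigma>) ?a) True"
    using le(1) by (simp add: nths_append_replicate)
  moreover have "nths ?\<sigma>2 I = nths ?\<sigma>1 I @ replicate (cnt I ?a n) False"
    using nths_append_replicate[of ?\<sigma>1 "n - ?a" False I] len le by simp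
  moreover have "nths (msg k n \<sigma>) I = nths ?\<sigma>2 I @ replicate (cnt I n (f n)) True"
    unfolding msg using nths_append_replicate[of ?\<sigma>2 "f n - n" True I] len le by simp
  ultimately have nths: "nths (msg k n \<sigma>) I = nths \<sigma> I @ replicate (cnt I (length \<sigma>) ?a) True @
      replicate (cnt I ?a n) False @ replicate (cnt I n (f n)) True" by simp
  have "Suc (bound k) \<le> cnt I k ?a"
    using cnt_funpow[OF gap, of "Suc (bound k)" k] by simp
  also have "\<dots> \<le> cnt I (length \<sigma>) ?a"
    using cnt_concat[of "length \<sigma>" k ?a I] assms(2) index_less_bound[of k] by linarith
  finally have c: "bound k < cnt I (length \<sigma>) ?a" by simp
  have c': "cnt I (length \<sigma>) ?a \<le> ?a" using cnt_le[of I "length \<sigma>" ?a] by linarith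
  obtain x where "x \<in> I" "?a \<le> x" "x < f ?a" using gap by blast
  then have r: "0 < cnt I ?a n" using assms(3) by (intro cnt_pos[of x]) auto
  obtain y where "y \<in> I" "n \<le> y" "y < f n" using gap by blast
  then have q: "0 < cnt I n (f n)" by (rule cnt_pos)
  have sum: "cnt I (length \<sigma>) ?a + cnt I ?a n = cnt I (length \<sigma>) n"
    using le by (intro cnt_concat)
  have "length (msg k n \<sigma>) = f n"
    unfolding msg length_append[of ?\<sigma>2] len length_replicate using le(3) by simp
  with nths c c' r q sum le(2) show thesis by (intro that)
qed

lemma length_le_msg_index: "length \<sigma> \<le> msg_index (string_code \<sigma>) e i"
  using length_le_string_code[of \<sigma>] le_pair_1[of "string_code \<sigma>" "pair e i"]
  unfolding msg_index_def by linarith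

lemma first_stage_exists:
  assumes "stage s e t" shows "\<exists>t. stage s e t \<and> (\<forall>t'<t. \<not> stage s e t')"
  using LeastI[of "stage s e", OF assms] not_less_Least by blast

text \<open>
  The heart of the proof.  The three cases are those described at the top: a special message
  followed by an extension in \<open>V\<close>; a message that is not special and has no extension in \<open>V\<close>; and
  the impossible case, in which the parity of \<open>R\<close> would be computable on a final segment and
  \<open>I\<close> would be decidable.
\<close>

lemma extend_parsed:
  assumes gap: "\<And>n. \<exists>x\<in>I. n \<le> x \<and> x < f n"
    and noncomp: "\<not> decidable (\<lambda>n. n \<in> I)"
    and V: "\<And>x. x \<in> string_code ` V \<longleftrightarrow> (\<exists>w. D e x w)"
    and parsed: "parsed (nths \<sigma> I)"
  shows "\<exists>\<rho> \<mu>. prefix \<sigma> \<mu> \<and> prefix \<mu> \<rho> \<and> parsed (nths \<rho> I) \<and> length \<sigma> < length \<rho> \<and>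
        (\<mu> \<in> V \<or> \<not> (\<exists>\<tau>. prefix \<mu> \<tau> \<and> \<tau> \<in> V))"
proof -
  define s where "s = string_code \<sigma>"
  define K where "K i = msg_index s e i" for i
  define R where "R n = cnt I (length \<sigma>) n" for n
  define U where "U i n \<longleftrightarrow> (\<exists>v. found s e i n v)" for i n
  have psnd_K: "psnd (psnd (K i)) = i" "pfst (K i) = s" "pfst (psnd (K i)) = e" for i
    by (simp_all add: K_def msg_index_def)
  have len_K: "length \<sigma> \<le> K i" for i by (simp add: K_def s_def length_le_msg_index)
  have inV: "string_code \<tau> \<in> string_code ` V \<longleftrightarrow> \<tau> \<in> V" for \<tau>
    using inj_image_mem_iff[OF bij_is_inj[OF bij_string_code]] .
  have found: "msg (K i) n \<sigma> @ z \<in> V \<and> f (bound (Suc (K i))) \<le> n"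
    if "found s e i n v" "pfst v = string_code z" for i n v z
  proof -
    have "D e (string_code (msg (K i) n \<sigma> @ z)) (psnd v)"
      using that by (simp add: found_def K_def s_def)
    then have "msg (K i) n \<sigma> @ z \<in> V" using V inV by blast
    then show ?thesis using that(1) by (simp add: found_def K_def)
  qed
  have U_ext: "U i n" if n: "f (bound (Suc (K i))) \<le> n"
    and ext: "\<exists>\<tau>. prefix (msg (K i) n \<sigma>) \<tau> \<and> \<tau> \<in> V" for i n
  proof -
    obtain z where "msg (K i) n \<sigma> @ z \<in> V" using ext by (auto simp: prefix_def)
    then obtain w where "D e (string_code (msg (K i) n \<sigma> @ z)) w" using V inV by blast
    then have "found s e i n (pair (string_code z) w)"
      using n by (simp add: found_def K_def s_def)
    then show ?thesis unfolding U_def by blast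
  qed
  have step_longer: "length \<sigma> < length \<rho>" if "step (nths \<sigma> I) (nths \<rho> I)" "prefix \<sigma> \<rho>" for \<rho>
  proof -
    have "nths \<sigma> I \<noteq> nths \<rho> I" using step_prefix[OF that(1)] by (auto simp: prefix_def)
    then have "\<sigma> \<noteq> \<rho>" by blast
    then show ?thesis using that(2) prefix_length_less by (metis prefix_order.le_less)
  qed
  have conclude: ?thesis
    if "step (nths \<sigma> I) (nths \<rho> I)" "prefix \<sigma> \<mu>" "prefix \<mu> \<rho>"
      "\<mu> \<in> V \<or> \<not> (\<exists>\<tau>. prefix \<mu> \<tau> \<and> \<tau> \<in> V)" for \<rho> \<mu>
  proof -
    have "parsed (nths \<rho> I)" using parsed that(1) by (rule rtranclp.rtrancl_into_rtrancl)
    moreover have "length \<sigma> < length \<rho>"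
      using step_longer[OF that(1)] that(2,3) by (meson prefix_order.trans)
    ultimately show ?thesis using that(2-4) by blast
  qed
  have prefix_msg: "prefix \<sigma> (msg k n \<sigma>)" for k n by (simp add: msg_def)
  \<comment> \<open>In the third case both ways of deciding \<open>V\<close> fail.\<close>
  consider (stage) t where "stage s e t"
    | (avoid) i n where "i < 2" "R n mod 2 \<noteq> i" "f (bound (Suc (K i))) \<le> n"
        "\<not> (\<exists>\<tau>. prefix (msg (K i) n \<sigma>) \<tau> \<and> \<tau> \<in> V)"
    | (neither) "\<And>t. \<not> stage s e t"
        "\<And>i n. i < 2 \<Longrightarrow> R n mod 2 \<noteq> i \<Longrightarrow> f (bound (Suc (K i))) \<le> n \<Longrightarrow> U i n"
    using U_ext by blast
  then show ?thesis
  proof cases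
    case stage
    from first_stage_exists[OF this] obtain t where t: "stage s e t" "\<And>t'. t' < t \<Longrightarrow> \<not> stage s e t'"
      by blast
    define n where "n = pfst t"
    \<comment> \<open>The bit is chosen last, and with knowledge of \<open>I\<close>, so as to make the message special.\<close>
    define i where "i = R n mod 2"
    have "\<exists>v. found s e i n v \<and> v \<le> t"
    proof (cases "i = 0")
      case True
      then show ?thesis using t(1) unfolding stage_def n_def
        by (meson le_trans pfst_le psnd_le)
    next
      case False
      then have "i = 1" unfolding i_def by simp
      then show ?thesis using t(1) unfolding stage_def n_def
        by (meson le_trans psnd_le)
    qed
    then obtain v where v: "found s e i n v" "v \<le> t" by blast
    obtain z where z: "pfst v = string_code z"
      using surjD[OF bij_is_surj[OF bij_string_code], of "pfst v"] by blast
    define \<mu> where "\<mu> = msg (K i) n \<sigma> @ z"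
    have \<mu>: "\<mu> \<in> V" and n: "f (bound (Suc (K i))) \<le> n"
      using found[OF v(1) z] by (simp_all add: \<mu>_def)
    have "length z \<le> t"
      using length_le_string_code[of z] z pfst_le[of v] v(2) by linarith
    obtain c r q where crq: "nths (msg (K i) n \<sigma>) I =
      nths \<sigma> I @ replicate c True @ replicate r False @ replicate q True"
      "bound (K i) < c" "c \<le> bound (Suc (K i))" "0 < r" "0 < q" "c + r = R n"
      and len: "length (msg (K i) n \<sigma>) = f n"
      using nths_msg[OF gap len_K n] unfolding R_def by metis
    obtain q' where q': "q = Suc q'" using crq(5) gr0_implies_Suc by blast
    define head where "head = nths \<sigma> I @ replicate c True @ replicate r False @ [True]"
    obtain y where y: "nths \<mu> I = head @ y"
      unfolding \<mu>_def nths_append crq(1) q' head_def by simp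
    have "length (nths \<mu> I) \<le> length \<mu>" by (simp add: length_nths card_mono[of "{..<length \<mu>}", simplified] subset_eq)
    then have "length (nths \<mu> I) \<le> f n + t"
      using \<open>length z \<le> t\<close> len by (simp add: \<mu>_def)
    then have "length (nths \<mu> I) \<le> length head + (f n + t)" by simp
    \<comment> \<open>The ignored stretch must have exactly the length that the reader computes.\<close>
    from padding[OF gap this, of True] obtain m where
      m: "length (nths (\<mu> @ replicate m True) I) = length head + (f n + t)" by blast
    define \<rho> where "\<rho> = \<mu> @ replicate m True"
    obtain u where u: "nths \<rho> I = head @ u"
      unfolding \<rho>_def nths_append y by simp
    have "length u = f (pfst t) + t" using m u unfolding \<rho>_def n_def by simp
    moreover have "special (K i) c r" by (simp add: special_def crq(6) psnd_K i_def)
    moreover have "first_stage (K i) t" using t by (simp add: first_stage_def psnd_K)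
    ultimately have "step (nths \<sigma> I) (nths \<rho> I)"
      unfolding step_def using crq(2-4) u unfolding head_def
      by (intro exI[of _ "K i"] exI[of _ c] exI[of _ r]) auto
    moreover have "prefix \<sigma> \<mu>" unfolding \<mu>_def using prefix_msg by (rule prefix_prefix)
    ultimately show ?thesis using \<mu> by (intro conclude[of \<rho> \<mu>]) (simp_all add: \<rho>_def)
  next
    case avoid
    obtain c r q where crq: "nths (msg (K i) n \<sigma>) I =
      nths \<sigma> I @ replicate c True @ replicate r False @ replicate q True"
      "bound (K i) < c" "c \<le> bound (Suc (K i))" "0 < r" "0 < q" "c + r = R n"
      using nths_msg[OF gap len_K avoid(3)] unfolding R_def by metis
    let ?\<mu> = "msg (K i) n \<sigma>"
    \<comment> \<open>A single \<open>0\<close> seen through \<open>I\<close> closes a message that is not special.\<close>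
    from padding[OF gap, of ?\<mu> "Suc (length (nths ?\<mu> I))" False] obtain m where
      m: "length (nths (?\<mu> @ replicate m False) I) = Suc (length (nths ?\<mu> I))" by auto
    then have "nths (?\<mu> @ replicate m False) I = nths ?\<mu> I @ [False]"
      by (simp add: nths_append_replicate)
    moreover have "\<not> special (K i) c r" using avoid(2) by (simp add: special_def crq(6) psnd_K)
    ultimately have "step (nths \<sigma> I) (nths (?\<mu> @ replicate m False) I)"
      unfolding step_def using crq(2-5)
      by (intro exI[of _ "K i"] exI[of _ c] exI[of _ r]) (auto simp: crq(1))
    then show ?thesis using avoid(4) prefix_msg by (intro conclude[of "?\<mu> @ replicate m False" ?\<mu>]) auto
  next
    case neither
    define n0 where "n0 = max (f (bound (Suc (K 0)))) (f (bound (Suc (K 1))))"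
    have n0: "f (bound (Suc (K i))) \<le> n0" if "i < 2" for i
      using that by (cases "i = 0") (auto simp: n0_def less_2_cases_iff)
    have not_both: "\<not> (U 0 n \<and> U 1 n)" for n
    proof
      assume "U 0 n \<and> U 1 n"
      then obtain v0 v1 where "found s e 0 n v0" "found s e 1 n v1" unfolding U_def by blast
      then have "stage s e (pair n (pair v0 v1))" by (simp add: stage_def)
      with neither(1) show False by blast
    qed
    have U0: "U 0 n \<longleftrightarrow> R n mod 2 = 1" and U1: "U 1 n \<longleftrightarrow> R n mod 2 = 0" if "n0 \<le> n" for n
    proof -
      have "R n mod 2 \<noteq> 0 \<Longrightarrow> U 0 n" using neither(2)[of 0 n] n0[of 0] that by simp
      moreover have "R n mod 2 \<noteq> 1 \<Longrightarrow> U 1 n" using neither(2)[of 1 n] n0[of 1] that by simp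
      ultimately show "U 0 n \<longleftrightarrow> R n mod 2 = 1" "U 1 n \<longleftrightarrow> R n mod 2 = 0"
        using not_both[of n] mod2_eq_if[of "R n"] by (auto split: if_splits)
    qed
    \<comment> \<open>Beyond \<open>\<bar>\<sigma>\<bar>\<close>, \<open>R\<close> increases exactly at the elements of \<open>I\<close>.\<close>
    have le_n0: "length \<sigma> \<le> n0"
      using len_K[of 0] index_less_bound[of "K 0"] less_f[of "bound (Suc (K 0))"] n0[of 0] by linarith
    have R_Suc: "R (Suc n) = R n + of_bool (n \<in> I)" if "n0 \<le> n" for n
      unfolding R_def using le_n0 that by (intro cnt_Suc) linarith
    have ce_U: "ce_pred (\<lambda>x. U i (n x))" if "computable n" for n i
      unfolding U_def
      by (intro ce_ex ce_decidable decidable_found computable_intros computable_compose[OF that])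
    have fin: "decidable (\<lambda>n. n \<in> I \<inter> {..<n0})" "decidable (\<lambda>n. n \<in> {..<n0} - I)"
      by (rule decidable_finite; simp)+
    have ge: "ce_pred (\<lambda>n. n0 \<le> n)"
      by (intro ce_decidable decidable_le computable_intros)
    have "ce_pred (\<lambda>n. n \<in> I \<inter> {..<n0} \<or> n0 \<le> n \<and> (U 0 n \<and> U 1 (Suc n) \<or> U 1 n \<and> U 0 (Suc n)))"
      by (intro ce_disj ce_conj ce_decidable[OF fin(1)] ge ce_U computable_intros)
    moreover have "n \<in> I \<inter> {..<n0} \<or> n0 \<le> n \<and> (U 0 n \<and> U 1 (Suc n) \<or> U 1 n \<and> U 0 (Suc n))
        \<longleftrightarrow> n \<in> I" for n
    proof (cases "n0 \<le> n")
      case True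
      then show ?thesis
        using U0[of n] U1[of n] U0[of "Suc n"] U1[of "Suc n"] R_Suc[OF True] by (auto; presburger)
    qed auto
    ultimately have pos: "ce_pred (\<lambda>n. n \<in> I)" by simp
    have "ce_pred (\<lambda>n. n \<in> {..<n0} - I \<or> n0 \<le> n \<and> (U 0 n \<and> U 0 (Suc n) \<or> U 1 n \<and> U 1 (Suc n)))"
      by (intro ce_disj ce_conj ce_decidable[OF fin(2)] ge ce_U computable_intros)
    moreover have "n \<in> {..<n0} - I \<or> n0 \<le> n \<and> (U 0 n \<and> U 0 (Suc n) \<or> U 1 n \<and> U 1 (Suc n))
        \<longleftrightarrow> n \<notin> I" for n
    proof (cases "n0 \<le> n")
      case True
      then show ?thesis
        using U0[of n] U1[of n] U0[of "Suc n"] U1[of "Suc n"] R_Suc[OF True] by (auto; presburger)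
    qed auto
    ultimately have neg: "ce_pred (\<lambda>n. n \<notin> I)" by simp
    from decidable_if_ce_and_co_ce[OF pos neg] noncomp show ?thesis by blast
  qed
qed

end

lemma generic_subsequence_if_gaps_bounded:
  assumes "infinite I" "\<not> decidable (\<lambda>n. n \<in> I)" "computable f"
    and gap: "\<And>n. \<exists>x\<in>I. n \<le> x \<and> x < f n"
  shows "\<exists>G. one_generic G \<and> \<not> one_generic (subsequence I G)"
proof -
  obtain D :: "nat \<Rightarrow> nat \<Rightarrow> nat \<Rightarrow> bool" where
    D: "decidable (\<lambda>z. D (pfst z) (pfst (psnd z)) (psnd (psnd z)))"
       "\<And>A. ce_set A \<Longrightarrow> \<exists>e. \<forall>x. x \<in> A \<longleftrightarrow> (\<exists>w. D e x w)"
    using universal_ce_set by metis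
  have less_f: "n < f n" for n using gap[of n] by auto
  interpret message_system f D by unfold_locales (rule assms(3), rule D(1), rule less_f)
  have "\<exists>\<rho> \<mu>. prefix \<sigma> \<mu> \<and> prefix \<mu> \<rho> \<and> parsed (nths \<rho> I) \<and> length \<sigma> < length \<rho> \<and>
        (\<mu> \<in> V \<or> \<not> (\<exists>\<tau>. prefix \<mu> \<tau> \<and> \<tau> \<in> V))"
    if "parsed (nths \<sigma> I)" "ce_strings V" for \<sigma> V
  proof -
    obtain e where "\<And>x. x \<in> string_code ` V \<longleftrightarrow> (\<exists>w. D e x w)"
      using D(2) \<open>ce_strings V\<close> unfolding ce_strings_def by blast
    from extend_parsed[OF gap assms(2) this that(1)] show ?thesis .
  qed
  moreover have "parsed (nths [] I)" by simp
  ultimately obtain G where G: "one_generic G"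
    "\<And>n. \<exists>\<sigma>. initial_segment \<sigma> G \<and> n \<le> length \<sigma> \<and> parsed (nths \<sigma> I)"
    using generic_from_extensions[of "\<lambda>\<sigma>. parsed (nths \<sigma> I)"] by blast
  have "\<exists>\<tau>. initial_segment \<tau> (subsequence I G) \<and> n \<le> length \<tau> \<and> parsed \<tau>" for n
  proof -
    obtain \<sigma> where \<sigma>: "initial_segment \<sigma> G" "(f ^^ n) 0 \<le> length \<sigma>" "parsed (nths \<sigma> I)"
      using G(2) by blast
    have "n \<le> cnt I 0 ((f ^^ n) 0)" using cnt_funpow[OF gap] by blast
    also have "\<dots> \<le> cnt I 0 (length \<sigma>)"
      using cnt_concat[of 0 "(f ^^ n) 0" "length \<sigma>" I] \<sigma>(2) by simp
    also have "\<dots> = length (nths \<sigma> I)"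
      using nths_append_replicate[of "[]" "length \<sigma>" True I]
      by (auto simp: length_nths cnt_def intro!: arg_cong[of _ _ card])
    finally show ?thesis using initial_segment_nths[OF assms(1) \<sigma>(1)] \<sigma>(3) by blast
  qed
  then have "\<not> one_generic (subsequence I G)" by (rule not_one_generic_if_parsed)
  with G(1) show ?thesis by blast
qed

theorem theorem4p7:
  "\<not> (\<exists>I. \<not> computable_set I \<and> subsequence_set_1_generic I) \<and>
   (\<forall>I. \<not> computable_set I \<longrightarrow>
     (\<exists>G. one_generic G \<and> \<not> one_generic (subsequence I G)))"
proof -
  have "\<exists>G. one_generic G \<and> \<not> one_generic (subsequence I G)" if I: "\<not> computable_set I" for I
  proof -
    have dec: "\<not> decidable (\<lambda>n. n \<in> I)"
      using I unfolding computable_set_def decidable_def .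
    then have inf: "infinite I" using decidable_finite by blast
    show ?thesis
    proof (cases "\<exists>f. computable f \<and> (\<forall>n. \<exists>x\<in>I. n \<le> x \<and> x < f n)")
      case True
      then show ?thesis using generic_subsequence_if_gaps_bounded[OF inf dec] by blast
    next
      case False
      then show ?thesis by (intro generic_subsequence_if_sparse inf) blast
    qed
  qed
  then show ?thesis unfolding subsequence_set_1_generic_def by blast
qed

end
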